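(* Let $0<|q|<1$ and fix $\lambda\in\mathbb{C}^*\setminus q^{\mathbb{Z}}$. Let $\widetilde{\psi}^{\mathrm{B}}_\lambda(x):=\left(\mathcal{L}^+_{q,\lambda}\circ\mathcal{B}^+_q\,{}_1\psi_0\right)(a;-;q,x)$ be the $q$-Borel-Laplace transform of the divergent bilateral series ${}_1\psi_0(a;-;q,x)=\sum_{n\in\mathbb{Z}}(a;q)_n(-1)^nq^{-\frac{n(n-1)}{2}}x^n$. Then for any $x\in\mathbb{C}^*\setminus[-\lambda;q]$, we have $$\widetilde{\psi}^{\mathrm{B}}_\lambda(x)=\frac{(q;q)_\infty}{(q/a;q)_\infty}\,\frac{\theta_q(a\lambda)\,\theta_q\!\left(\frac{aqx}{\lambda}\right)}{\theta_q(\lambda)\,\theta_q\!\left(\frac{qx}{\lambda}\right)}\;{}_1\varphi_0\!\left(0;-;q,\frac{1}{ax}\right).$$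
   Context: Notation. $(a;q)_0=1$, $(a;q)_n=(1-a)(1-aq)\cdots(1-aq^{n-1})$ for $n\ge1$, $(a;q)_n=\left[(1-aq^{-1})(1-aq^{-2})\cdots(1-aq^{n})\right]^{-1}$ for $n\le-1$, and $(a;q)_\infty=\lim_{n\to\infty}(a;q)_n$. The theta function is $\theta_q(z)=\sum_{n\in\mathbb{Z}}q^{n(n-1)/2}z^n$ for $z\in\mathbb{C}^*$. $[-\lambda;q]=\{-\lambda q^k:k\in\mathbb{Z}\}$. ${}_1\varphi_0(0;-;q,z)=\sum_{n\ge0}\frac{z^n}{(q;q)_n}$. $q$-Borel transformation: $(\mathcal{B}^+_qf)(\xi)=\sum_n a_nq^{n(n-1)/2}\xi^n$ for a formal series $f(x)=\sum_n a_nx^n$, applied here termwise to a bilateral series ($n\in\mathbb{Z}$). It sends ${}_1\psi_0(a;-;q,x)$ to $\psi_{\mathrm{B}}(\xi)=\sum_{n\in\mathbb{Z}}(a;q)_n(-\xi)^n$, which is evaluated, by Ramanujan's ${}_1\psi_1$ summation, as $\psi_{\mathrm{B}}(\xi)=\frac{(q;q)_\infty}{(q/a;q)_\infty}\frac{\theta_q(a\xi)}{\theta_q(\xi)}\left(-\frac{q}{\xi};q\right)_\infty$. $q$-Laplace transformation: $(\mathcal{L}^+_{q,\lambda}\varphi)(x)=\sum_{n\in\mathbb{Z}}\frac{\varphi(\lambda q^n)}{\theta_q(\lambda q^n/x)}$. Thus $\widetilde{\psi}^{\mathrm{B}}_\lambda(x)=\sum_{n\in\mathbb{Z}}\frac{\psi_{\mathrm{B}}(\lambda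 q^n)}{\theta_q(\lambda q^n/x)}$.
   Formalization: The condition on λ is λ∉-q^ℤ instead of λ∉q^ℤ, since θ_q(λ)=0 at λ=-1; a≠0 and a≠q^k (k≥1) are assumed so all terms are defined; where the Borel, Laplace or 1φ0 series diverges, it is read as its meromorphic continuation. *)

theory Defs
  imports "HOL-Complex_Analysis.Complex_Analysis"
begin

text \<open>\<open>q\<close>-shifted factorials with integer index, and the infinite product. For \<open>n < 0\<close> the
  factorial is meaningful only if \<open>a\<close> is not one of \<open>q, q\<^sup>2, \<dots>, q\<^bsup>-n\<^esup>\<close>.\<close>

definition qfact :: "complex \<Rightarrow> complex \<Rightarrow> int \<Rightarrow> complex" where
  "qfact a q n =
     (if n \<ge> 0 then \<Prod>k<nat n. 1 - a * q ^ k
      else inverse (\<Prod>k=1..nat (-n). 1 - a * q powi (- int k)))"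

definition qfact_inf :: "complex \<Rightarrow> complex \<Rightarrow> complex" where
  "qfact_inf a q = lim (\<lambda>n. qfact a q (int n))"

text \<open>For \<open>0 < \<bar>q\<bar> < 1\<close> the zeros of \<open>theta q\<close> in the punctured plane are exactly the points of
  \<open>q_spiral (-1) q\<close>.\<close>

definition theta :: "complex \<Rightarrow> complex \<Rightarrow> complex" where
  "theta q z = (\<Sum>\<^sub>\<infinity>n\<in>(UNIV::int set). q powi (n * (n - 1) div 2) * z powi n)"

definition q_spiral :: "complex \<Rightarrow> complex \<Rightarrow> complex set" where
  "q_spiral c q = {c * q powi k | k::int. True}"

text \<open>The sum of a series of functions, continued meromorphically to \<open>E\<close>. It is equal to the
  ordinary sum at every point of \<open>E\<close> where the series converges. When \<open>E\<close> is open and connected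
  and the series converges on a nonempty open subset, there is at most one such continuation, since
  \<^const>\<open>nicely_meromorphic_on\<close> fixes the values at removable singularities (the limit) and at poles
  (zero). The series need not converge on all of \<open>E\<close>.\<close>

definition continued_sum ::
    "complex set \<Rightarrow> ('i \<Rightarrow> complex \<Rightarrow> complex) \<Rightarrow> complex \<Rightarrow> complex" where
  "continued_sum E t = (SOME g. g nicely_meromorphic_on E \<and>
     (\<forall>z\<in>E. (\<lambda>n. t n z) summable_on UNIV \<longrightarrow> g z = (\<Sum>\<^sub>\<infinity>n. t n z)))"

text \<open>For \<open>0 < \<bar>q\<bar> < 1\<close> the series converges for \<open>\<bar>z\<bar> < 1\<close> only.\<close>

definition phi_1_0 :: "complex \<Rightarrow> complex \<Rightarrow> complex" where
  "phi_1_0 q = continued_sum UNIV (\<lambda>(n::nat) z. z ^ n / qfact q q (int n))"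

text \<open>Formal bilateral series are represented by their coefficients \<^typ>\<open>int \<Rightarrow> complex\<close>.\<close>

definition psi_1_0 :: "complex \<Rightarrow> complex \<Rightarrow> int \<Rightarrow> complex" where
  "psi_1_0 a q n = qfact a q n * (-1) powi n * q powi (- (n * (n - 1) div 2))"

text \<open>For \<^const>\<open>psi_1_0\<close> the series below converges in the punctured unit disc (for generic
  \<open>a\<close> only there), whereas the Laplace transformation evaluates its sum at \<open>\<lambda>q\<^sup>n\<close> for all
  integers \<open>n\<close>.\<close>

definition q_borel :: "complex \<Rightarrow> (int \<Rightarrow> complex) \<Rightarrow> complex \<Rightarrow> complex" where
  "q_borel q c = continued_sum (- {0})
     (\<lambda>n \<xi>. c n * q powi (n * (n - 1) div 2) * \<xi> powi n)"

text \<open>The removed points are those where some denominator vanishes. Applied to the Borel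
  transform of \<^const>\<open>psi_1_0\<close>, the series converges for \<open>\<bar>a x\<bar> > 1\<close> (for generic parameters
  only there).\<close>

definition q_laplace :: "complex \<Rightarrow> complex \<Rightarrow> (complex \<Rightarrow> complex) \<Rightarrow> complex \<Rightarrow> complex" where
  "q_laplace q l \<phi> = continued_sum (- {0} - q_spiral (- l) q)
     (\<lambda>(n::int) x. \<phi> (l * q powi n) / theta q (l * q powi n / x))"

end

theory Submission
  imports Defs
begin

text \<open>Write \<open>(z)\<close> for \<open>qfact_inf z q\<close>. The \<open>q\<close>-binomial series with parameter \<open>a q\<^sup>-\<^sup>M\<close>, shifted by \<open>M\<close>, is
  the bilateral series with lower parameter \<open>q\<^sup>M\<^sup>+\<^sup>1\<close>; letting \<open>M \<longlongrightarrow> \<infinity>\<close> under dominated convergence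
  gives Ramanujan's sum \<open>\<Sum> (a;q)\<^sub>n z\<^sup>n = (q) (az) (q/(az)) / ((q/a) (z))\<close>. Its case \<open>a = q\<^sup>-\<^sup>M\<close>, again
  with \<open>M \<longlongrightarrow> \<infinity>\<close>, is the Jacobi triple product, whence the zeros and the quasi-periodicity of \<open>theta\<close>.

  Ramanujan's sum gives the Borel transform as \<open>\<theta>(a\<xi>) / ((-\<xi>) (q/a))\<close>. By quasi-periodicity the
  \<open>n\<close>-th term of the Laplace transform is then a constant times \<open>(-\<lambda>;q)\<^sub>n (1/(ax))\<^sup>n\<close>, so that
  Ramanujan's sum applies a second time, now with parameter \<open>-\<lambda>\<close>. All continuations are
  quotients of holomorphic functions and are identified with \<open>continued_sum\<close> by the identity theorem.\<close>

section \<open>Sums over the integers: dominated convergence, summability, recurrences\<close>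

lemma qfact_of_nat: "qfact a q (int n) = (\<Prod>k<n. 1 - a * q ^ k)"
  by (simp add: qfact_def)

lemma qfact_neg_of_nat: "qfact a q (- int n) = inverse (\<Prod>k=1..n. 1 - a / q ^ k)"
  by (cases "n = 0") (auto simp: qfact_def power_int_minus divide_inverse)

text \<open>An absolutely summable family is an integrable function for the counting measure, so
  Lebesgue's theorem applies. All limits \<open>M\<close> to infinity below rest on this.\<close>

lemma infsum_dominated_convergence:
  fixes f :: "nat \<Rightarrow> 'b \<Rightarrow> complex" and g :: "'b \<Rightarrow> real"
  assumes g: "g summable_on UNIV" and le: "\<And>n k. norm (f n k) \<le> g k"
    and lim: "\<And>k. (\<lambda>n. f n k) \<longlonglongrightarrow> h k"
  shows "(\<lambda>n. infsum (f n) UNIV) \<longlonglongrightarrow> infsum h UNIV"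
proof -
  have nn: "0 \<le> g k" for k using le[of 0 k] norm_ge_zero order_trans by blast
  have hle: "norm (h k) \<le> g k" for k
    by (rule tendsto_upperbound[OF tendsto_norm[OF lim]]) (auto simp: le)
  have g': "Infinite_Sum.abs_summable_on g UNIV"
    using g nn by simp
  have ab: "Infinite_Set_Sum.abs_summable_on g UNIV" 
    using g' abs_summable_equivalent by blast
  have int_g: "integrable (count_space UNIV) g"
    using ab by (simp add: Infinite_Set_Sum.abs_summable_on_def)
  have *: "infsum u UNIV = integral\<^sup>L (count_space UNIV) u" if "\<And>k. norm (u k) \<le> g k" for u :: "'b \<Rightarrow> complex"
  proof -
    have "Infinite_Sum.abs_summable_on u UNIV"
      by (rule summable_on_comparison_test[OF g]) (use that in auto)
    then have "Infinite_Set_Sum.abs_summable_on u UNIV" 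
      using abs_summable_equivalent by blast
    then show ?thesis
      by (simp add: infsetsum_infsum[symmetric] infsetsum_def)
  qed
  have "(\<lambda>n. integral\<^sup>L (count_space UNIV) (f n)) \<longlonglongrightarrow> integral\<^sup>L (count_space UNIV) h"
    by (rule integral_dominated_convergence[where w=g]) (auto simp: int_g le lim)
  then show ?thesis using *[OF le] *[OF hle] by simp
qed

lemma summable_on_intI:
  fixes f :: "int \<Rightarrow> 'a :: banach"
  assumes "summable (\<lambda>n. norm (f (int n)))" and "summable (\<lambda>n. norm (f (- int n)))"
  shows "f summable_on UNIV"
proof -
  have "f summable_on range int"
    by (subst summable_on_reindex) (auto simp: o_def intro!: norm_summable_imp_summable_on assms)
  moreover have "(\<lambda>n::nat. f (- int n)) summable_on UNIV"
    by (auto simp: o_def intro!: norm_summable_imp_summable_on assms)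
  then have "f summable_on range (\<lambda>n. - int n)"
    by (subst summable_on_reindex) (auto simp: o_def inj_on_def)
  ultimately have "f summable_on (range int \<union> range (\<lambda>n. - int n))"
    \<comment> \<open>The two ranges share the index 0, so the union is first rewritten as a
      disjoint one.\<close>
    by (metis (no_types, lifting) summable_on_Un_disjoint summable_on_subset_banach Diff_disjoint Un_Diff_cancel Diff_subset)
  moreover have "range int \<union> range (\<lambda>n. - int n) = UNIV"
    by (auto simp: image_iff) (metis int_cases2)
  ultimately show ?thesis by simp
qed

lemma summable_ratio_tendsto_0:
  fixes f :: "nat \<Rightarrow> complex"
  assumes "\<And>n. f (Suc n) = r n * f n" and "r \<longlonglongrightarrow> 0"
  shows "summable (\<lambda>n. norm (f n))"
proof -
  have "eventually (\<lambda>n. norm (r n) < 1/2) sequentially"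
    using order_tendstoD(2)[OF tendsto_norm_zero[OF assms(2)], of "1/2"] by simp
  then obtain N where N: "\<And>n. n \<ge> N \<Longrightarrow> norm (r n) < 1/2"
    by (auto simp: eventually_sequentially)
  show ?thesis
  proof (rule summable_ratio_test[of "1/2" N])
    fix n assume "n \<ge> N"
    then show "norm (norm (f (Suc n))) \<le> 1/2 * norm (norm (f n))"
      using mult_right_mono[OF less_imp_le[OF N[of n]], of "norm (f n)"] by (simp add: assms(1) norm_mult)
  qed simp
qed

text \<open>Going down from 0 requires division by \<open>r n\<close>, going up does not.
  Nonvanishing is therefore asked at negative \<open>n\<close> only, which matters in
  \<open>qfact_inverse_power\<close>, where the factor vanishes at \<open>n = M\<close>.\<close>

lemma int_recurrence_unique:
  fixes f g r :: "int \<Rightarrow> 'a :: field"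
  assumes "f 0 = g 0" and f: "\<And>n. f (n + 1) = r n * f n" and g: "\<And>n. g (n + 1) = r n * g n"
    and "\<And>n. n < 0 \<Longrightarrow> r n \<noteq> 0"
  shows "f n = g n"
proof (induction n rule: int_induct[where k=0])
  case (step2 i)
  then show ?case using f[of "i - 1"] g[of "i - 1"] assms(4)[of "i - 1"] by simp
qed (use assms in auto)

lemma triangle_exponent_Suc: "(n + 1) * n div 2 = n * (n - 1) div 2 + (n::int)"
proof -
  have "(n + 1) * n = n * (n - 1) + n * 2" by (simp add: algebra_simps)
  then show ?thesis by simp
qed

lemma summable_geometric_series_if:
  fixes c :: "nat \<Rightarrow> complex"
  assumes "convergent c" "norm z < 1"
  shows "summable (\<lambda>n. norm (c n * z ^ n))"
proof -
  obtain B where B: "\<And>n. norm (c n) \<le> B"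
    using convergent_imp_Bseq[OF assms(1)] by (auto simp: Bseq_def)
  show ?thesis
    by (rule summable_comparison_test'[of "\<lambda>n. B * norm z ^ n" 0])
      (use assms(2) B in \<open>auto simp: norm_mult norm_power intro!: summable_mult summable_geometric mult_right_mono\<close>)
qed

section \<open>Evaluating continued sums by the identity theorem\<close>

text \<open>The quotient \<open>A / B\<close> with removable singularities filled in is an
  admissible continuation, and any admissible one agrees with it on \<open>V\<close>, hence on
  \<open>E\<close> up to isolated points. \<open>cont\<close> covers convergence of the series at a
  zero of \<open>B\<close>, where the filled-in value must be shown to be the sum. The last
  hypothesis excludes \<open>0 / 0\<close>; at a genuine pole both sides are 0, since
  \<open>x / 0 = 0\<close>.\<close>

lemma continued_sum_eq:
  fixes t :: "'i \<Rightarrow> complex \<Rightarrow> complex"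
  assumes E: "open E" "connected E" and hol: "A holomorphic_on E" "B holomorphic_on E"
    and V: "open V" "V \<noteq> {}" "V \<subseteq> E" "\<And>w. w \<in> V \<Longrightarrow> B w \<noteq> 0"
      "\<And>w. w \<in> V \<Longrightarrow> (\<lambda>n. t n w) summable_on UNIV"
    and eq: "\<And>w. w \<in> E \<Longrightarrow> (\<lambda>n. t n w) summable_on UNIV \<Longrightarrow> (\<Sum>\<^sub>\<infinity>n. t n w) * B w = A w"
    and cont: "\<And>w. w \<in> E \<Longrightarrow> (\<lambda>n. t n w) summable_on UNIV \<Longrightarrow> B w = 0 \<Longrightarrow> 
      isCont (\<lambda>w. \<Sum>\<^sub>\<infinity>n. t n w) w \<and> (\<forall>\<^sub>F u in at w. (\<lambda>n. t n u) summable_on UNIV)"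
    and z: "z \<in> E" "A z \<noteq> 0 \<or> B z \<noteq> 0"
  shows "continued_sum E t z = A z / B z"
proof -
  define F where "F = (\<lambda>w. A w / B w)"
  define h where "h = (\<lambda>w. \<Sum>\<^sub>\<infinity>n. t n w)"
  obtain v where v: "v \<in> V" "v \<in> E" "B v \<noteq> 0" using V by blast
  have ev: "\<forall>\<^sub>F u in at w. B u \<noteq> 0 \<and> u \<in> E" if "w \<in> E" for w
    by (rule non_zero_neighbour_alt[OF hol(2) E that v(2,3)])
  have an: "A analytic_on E" "B analytic_on E" using hol E by (simp_all add: analytic_on_open)
  have mero: "A meromorphic_on E" "B meromorphic_on E"
    using an by (simp_all add: analytic_on_imp_meromorphic_on)
  then have Fmero: "F meromorphic_on E"
    unfolding F_def by (rule meromorphic_on_divide)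
  have Fan: "F analytic_on {w}" if "w \<in> E" "B w \<noteq> 0" for w
    unfolding F_def using an that by (intro analytic_on_divide) (auto intro: analytic_on_subset)
  have F_h: "F w = h w" if "w \<in> E" "(\<lambda>n. t n w) summable_on UNIV" "B w \<noteq> 0" for w
    using eq[OF that(1,2)] that(3) by (simp add: F_def h_def field_simps)
  define P where "P = (\<lambda>g. g nicely_meromorphic_on E \<and>
     (\<forall>w\<in>E. (\<lambda>n. t n w) summable_on UNIV \<longrightarrow> g w = (\<Sum>\<^sub>\<infinity>n. t n w)))"
  \<comment> \<open>A witness is needed before \<open>SOME\<close> yields any information about
    \<open>continued_sum\<close>.\<close>
  have "P (remove_sings F)"
    unfolding P_def
  proof (intro conjI ballI impI)
    show "remove_sings F nicely_meromorphic_on E"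
      by (rule remove_sings_nicely_meromorphic[OF Fmero])
    fix w assume w: "w \<in> E" and sm: "(\<lambda>n. t n w) summable_on UNIV"
    show "remove_sings F w = (\<Sum>\<^sub>\<infinity>n. t n w)"
    proof (cases "B w = 0")
      case False
      then show ?thesis using Fan[OF w] F_h[OF w sm] by (simp add: h_def)
    next
      case True
      from cont[OF w sm True] have c: "isCont h w" and s: "\<forall>\<^sub>F u in at w. (\<lambda>n. t n u) summable_on UNIV"
        by (auto simp: h_def[abs_def])
      \<comment> \<open>Zeros of \<open>B\<close> are isolated, so \<open>F\<close> equals the sum
        on a punctured neighbourhood, and continuity of the sum gives the limit of
        \<open>F\<close>.\<close>
      have "\<forall>\<^sub>F u in at w. h u = F u"
        using ev[OF w] s by eventually_elim (use F_h in auto)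
      moreover have "h \<midarrow>w\<rightarrow> h w" using c by (simp add: isCont_def)
      ultimately have "F \<midarrow>w\<rightarrow> h w" by (rule Lim_transform_eventually[rotated])
      then show ?thesis by (auto simp: h_def)
    qed
  qed
  then have "P (SOME g. P g)" by (rule someI[of P])
  then have "P (continued_sum E t)" by (simp add: continued_sum_def P_def)
  then obtain g where g_def: "g = continued_sum E t" and g: "g nicely_meromorphic_on E"
    and gs: "\<And>w. w \<in> E \<Longrightarrow> (\<lambda>n. t n w) summable_on UNIV \<Longrightarrow> g w = h w"
    by (auto simp: P_def h_def)
  \<comment> \<open>Working with \<open>g * B - A\<close> avoids the poles of \<open>A / B\<close>.
    Such a function vanishes, or is nonzero, outside a sparse set; the second case contradicts the
    series identity on \<open>V\<close>.\<close>
  have "(\<lambda>w. g w * B w - A w) meromorphic_on E"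
    using g mero by (intro meromorphic_intros) (auto simp: nicely_meromorphic_on_def)
  then consider "\<forall>\<^sub>F w in cosparse E. g w * B w - A w = 0" | "\<forall>\<^sub>F w in cosparse E. g w * B w - A w \<noteq> 0"
    using meromorphic_imp_constant_or_avoid E by blast
  then have D: "\<forall>\<^sub>F w in at u. g w * B w - A w = 0" if "u \<in> E" for u
  proof cases
    case 2
    then have "\<forall>\<^sub>F w in at v. g w * B w - A w \<noteq> 0"
      using v E by (simp add: eventually_cosparse_open_eq)
    moreover have "\<forall>\<^sub>F w in at v. w \<in> V" using v V by (intro eventually_at_in_open')
    ultimately have "\<forall>\<^sub>F w in at v. False"
    proof eventually_elim
      case (elim w)
      then have "g w * B w = A w"
        using gs[of w] eq[of w] V by (auto simp: h_def)
      then show ?case using elim by simp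
    qed
    then show ?thesis by simp
  qed (use that E in \<open>simp add: eventually_cosparse_open_eq\<close>)
  \<comment> \<open>Agreement near \<open>z\<close> is now upgraded to agreement at
    \<open>z\<close>: the nicely meromorphic \<open>g\<close> takes its limit there, or 0 at a
    pole.\<close>
  have gF: "\<forall>\<^sub>F w in at z. F w = g w"
    using D[OF z(1)] ev[OF z(1)] by eventually_elim (auto simp: F_def field_simps)
  have nice: "is_pole g z \<and> g z = 0 \<or> g \<midarrow>z\<rightarrow> g z"
    using g z by (auto simp: nicely_meromorphic_on_def)
  have "g z = F z"
  proof (cases "B z = 0")
    case False
    have "F \<midarrow>z\<rightarrow> F z"
      using Fan[OF z(1) False] analytic_at_imp_isCont isCont_def by blast
    then have lim: "g \<midarrow>z\<rightarrow> F z" using gF by (rule Lim_transform_eventually)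
    then have "\<not> is_pole g z"
      using not_tendsto_and_filterlim_at_infinity[of "at z" g "F z"] unfolding is_pole_def by auto
    then have "g \<midarrow>z\<rightarrow> g z" using nice by blast
    then show ?thesis using lim by (rule LIM_unique)
  next
    case True
    have c: "isCont A z" "isCont B z"
      using an z by (meson analytic_at_imp_isCont analytic_on_analytic_at)+
    have "filterlim B (at 0) (at z)"
      using c(2) ev[OF z(1)] True by (auto simp: filterlim_at isCont_def elim: eventually_mono)
    then have "is_pole F z"
      unfolding F_def using c z True by (intro is_pole_divide) auto
    then have "is_pole g z" using is_pole_cong[OF gF refl] by simp
    then have "g z = 0"
      using nice not_tendsto_and_filterlim_at_infinity[of "at z" g] unfolding is_pole_def by auto
    then show ?thesis using True by (simp add: F_def)
  qed
  then show ?thesis by (simp add: g_def F_def)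
qed

text \<open>Absolute convergence on an inner and an outer circle dominates every term in the annulus
  between them. It supplies the continuity that \<open>continued_sum_eq\<close> asks for when the
  Borel series converges at a zero of the denominator.\<close>

lemma isCont_laurent_sum:
  fixes c :: "int \<Rightarrow> complex"
  assumes sm: "\<And>w. w \<noteq> 0 \<Longrightarrow> (\<lambda>n. c n * w powi n) summable_on UNIV" and z: "z \<noteq> 0"
  shows "isCont (\<lambda>w. \<Sum>\<^sub>\<infinity>n. c n * w powi n) z"
  unfolding isCont_def LIMSEQ_SEQ_conv[symmetric]
proof (intro allI impI)
  fix X assume X: "(\<forall>n. X n \<noteq> z) \<and> X \<longlonglongrightarrow> z"
  \<comment> \<open>Circles on either side of \<open>z\<close>: the outer one bounds the nonnegative
    powers, the inner one the negative powers.\<close>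
  define r where "r = norm z / 2"
  define R where "R = 2 * norm z"
  have r: "0 < r" "r < norm z" "norm z < R" "0 < R" using z by (auto simp: r_def R_def)
  have nX: "(\<lambda>n. norm (X n)) \<longlonglongrightarrow> norm z" using X by (intro tendsto_norm) auto
  have "\<forall>\<^sub>F n in sequentially. r < norm (X n) \<and> norm (X n) < R"
    using order_tendstoD[OF nX] r by (intro eventually_conj) auto
  then obtain N where N: "\<And>n. n \<ge> N \<Longrightarrow> r < norm (X n) \<and> norm (X n) < R"
    by (auto simp: eventually_sequentially)
  define g where "g = (\<lambda>n. norm (c n * of_real r powi n) + norm (c n * of_real R powi n))"
  have "(\<lambda>k. \<Sum>\<^sub>\<infinity>n. c n * X (k + N) powi n) \<longlonglongrightarrow> (\<Sum>\<^sub>\<infinity>n. c n * z powi n)"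
  proof (rule infsum_dominated_convergence)
    show "g summable_on UNIV"
      unfolding g_def using r
      by (intro summable_on_add summable_on_iff_abs_summable_on_complex[THEN iffD1] sm) auto
    fix k and n :: int
    have b: "r \<le> norm (X (k + N))" "norm (X (k + N)) \<le> R" using N[of "k + N"] by auto
    have "norm (X (k + N)) powi n \<le> r powi n + R powi n"
    proof (cases "n \<ge> 0")
      case True
      have "norm (X (k + N)) powi n \<le> R powi n" by (rule power_int_mono) (use True b in auto)
      moreover have "0 \<le> r powi n" using r by simp
      ultimately show ?thesis by linarith
    next
      case False
      have "norm (X (k + N)) powi n \<le> r powi n" by (rule power_int_antimono) (use False b r in auto)
      moreover have "0 \<le> R powi n" using r by simp
      ultimately show ?thesis by linarith
    qed
    then have "norm (c n) * norm (X (k + N)) powi n \<le> norm (c n) * (r powi n + R powi n)"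
      by (rule mult_left_mono) simp
    then show "norm (c n * X (k + N) powi n) \<le> g n"
      using r by (simp add: g_def norm_mult norm_power_int distrib_left)
  next
    fix n :: int
    show "(\<lambda>k. c n * X (k + N) powi n) \<longlonglongrightarrow> c n * z powi n"
      using X z by (intro tendsto_intros LIMSEQ_ignore_initial_segment) auto
  qed
  then show "(\<lambda>k. \<Sum>\<^sub>\<infinity>n. c n * X k powi n) \<longlonglongrightarrow> (\<Sum>\<^sub>\<infinity>n. c n * z powi n)"
    by (rule LIMSEQ_offset)
qed

text \<open>Deleting a countable set keeps the punctured plane connected; the domain of the Laplace
  transform needs this for the identity theorem.\<close>

lemma countable_q_spiral: "countable (q_spiral c q)"
proof -
  have "q_spiral c q = range (\<lambda>k::int. c * q powi k)" by (auto simp: q_spiral_def)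
  then show ?thesis by simp
qed

section \<open>The infinite product as an entire function, and the \<open>q\<close>-binomial
  theorem\<close>

context
  fixes q :: complex
  assumes q0: "q \<noteq> 0" and q1: "norm q < 1"
begin

lemma summable_q: "summable (\<lambda>k. norm (c * q ^ k))"
  using q1 by (auto simp: norm_mult norm_power intro!: summable_mult summable_geometric)

lemma convergent_prod_qfact: "convergent_prod (\<lambda>k. 1 - z * q ^ k)"
proof -
  have "abs_convergent_prod (\<lambda>k. 1 - z * q ^ k)"
    by (rule summable_imp_abs_convergent_prod) (use summable_q[of z] in simp)
  then show ?thesis by (rule abs_convergent_prod_imp_convergent_prod)
qed

lemma LIMSEQ_prodinf: "(\<lambda>n. \<Prod>k<n. 1 - z * q ^ k) \<longlonglongrightarrow> (\<Prod>k. 1 - z * q ^ k)"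
  using convergent_prod_LIMSEQ[OF convergent_prod_qfact[of z]]
  by (simp add: LIMSEQ_lessThan_iff_atMost)

lemma qfact_inf_eq: "qfact_inf z q = (\<Prod>k. 1 - z * q ^ k)"
  unfolding qfact_inf_def qfact_of_nat by (rule limI[OF LIMSEQ_prodinf])

lemma LIMSEQ_qfact_inf: "(\<lambda>n. \<Prod>k<n. 1 - z * q ^ k) \<longlonglongrightarrow> qfact_inf z q"
  unfolding qfact_inf_eq by (rule LIMSEQ_prodinf)

lemma qfact_inf_eq_0_iff: "qfact_inf z q = 0 \<longleftrightarrow> (\<exists>k. z * q ^ k = 1)"
proof -
  have "(\<lambda>k. 1 - z * q ^ k) has_prod qfact_inf z q"
    unfolding qfact_inf_eq by (rule convergent_prod_has_prod[OF convergent_prod_qfact])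
  from has_prod_eq_0_iff[OF this] show ?thesis
    by (auto simp: image_iff)
qed

lemma qfact_inf_nz: "norm z < 1 \<Longrightarrow> qfact_inf z q \<noteq> 0"
proof
  assume z: "norm z < 1" "qfact_inf z q = 0"
  then obtain k where "z * q ^ k = 1" using qfact_inf_eq_0_iff by blast
  then have "norm z * norm q ^ k = 1" by (metis norm_mult norm_power norm_one)
  moreover have "norm q ^ k \<le> 1" using q1 by (simp add: power_le_one)
  ultimately show False using z mult_left_le[of "norm q ^ k" "norm z"] by simp
qed

lemma qfact_inf_split: "qfact_inf z q = (\<Prod>k<n. 1 - z * q ^ k) * qfact_inf (z * q ^ n) q"
proof -
  have "(\<lambda>m. \<Prod>k<m+n. 1 - z * q ^ k) \<longlonglongrightarrow> qfact_inf z q"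
    using LIMSEQ_ignore_initial_segment[OF LIMSEQ_qfact_inf] .
  moreover have "(\<Prod>k<m+n. 1 - z * q ^ k) = (\<Prod>k<n. 1 - z * q ^ k) * (\<Prod>k<m. 1 - z * q ^ n * q ^ k)" for m
    by (induction m) (simp_all add: power_add algebra_simps)
  moreover have "(\<lambda>m. (\<Prod>k<n. 1 - z * q ^ k) * (\<Prod>k<m. 1 - z * q ^ n * q ^ k)) \<longlonglongrightarrow>
      (\<Prod>k<n. 1 - z * q ^ k) * qfact_inf (z * q ^ n) q"
    by (intro tendsto_mult tendsto_const LIMSEQ_qfact_inf)
  ultimately show ?thesis using LIMSEQ_unique by auto
qed

lemma qfact_inf_step: "qfact_inf z q = (1 - z) * qfact_inf (q * z) q"
  using qfact_inf_split[of z 1] by (simp add: mult.commute)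

lemma qfact_inf_0 [simp]: "qfact_inf 0 q = 1"
  unfolding qfact_inf_def qfact_of_nat by simp

text \<open>The partial products converge uniformly on every closed unit disc, because there
  \<open>norm x\<close> is at most \<open>norm z + 1\<close> and the geometric series dominates the
  deviations of the factors from 1.\<close>

lemma qfact_inf_holomorphic: "(\<lambda>z. qfact_inf z q) holomorphic_on UNIV"
proof (rule holomorphic_uniform_sequence)
  fix z :: complex
  let ?K = "cball z 1"
  have "uniformly_convergent_on ?K (\<lambda>N x. \<Prod>n<N. 1 - x * q ^ n)"
  proof (rule uniformly_convergent_on_prod')
    have "uniformly_convergent_on ?K (\<lambda>N x. \<Sum>n<N. norm ((1 - x * q ^ n) - 1))"
    proof (rule Weierstrass_m_test')
      show "summable (\<lambda>n. norm ((norm z + 1) * q ^ n))"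
        using summable_q[of "of_real (norm z + 1)"] by simp
      fix n x assume "x \<in> ?K"
      then have "norm x \<le> norm z + 1" 
        using norm_triangle_ineq2[of x z] by (auto simp: dist_norm norm_minus_commute)
      then show "norm (norm ((1 - x * q ^ n) - 1)) \<le> norm ((norm z + 1) * q ^ n)"
        by (auto simp: norm_mult intro!: mult_right_mono)
    qed
    then show "uniformly_convergent_on ?K (\<lambda>N x. \<Sum>n<N. norm ((1 - x * q ^ n) - 1))" .
  qed (auto intro!: continuous_intros)
  then obtain g where g: "uniform_limit ?K (\<lambda>N x. \<Prod>n<N. 1 - x * q ^ n) g sequentially"
    by (auto simp: uniformly_convergent_on_def)
  have "g x = qfact_inf x q" if "x \<in> ?K" for x
    using tendsto_uniform_limitI[OF g that] LIMSEQ_qfact_inf LIMSEQ_unique by blast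
  then have "uniform_limit ?K (\<lambda>N x. \<Prod>n<N. 1 - x * q ^ n) (\<lambda>z. qfact_inf z q) sequentially"
    using g by (metis (no_types, lifting) uniform_limit_cong')
  then show "\<exists>d>0. cball z d \<subseteq> UNIV \<and> 
      uniform_limit (cball z d) (\<lambda>N x. \<Prod>n<N. 1 - x * q ^ n) (\<lambda>z. qfact_inf z q) sequentially"
    by (intro exI[of _ 1]) auto
qed (auto intro!: holomorphic_intros)

lemma qfact_inf_holomorphic_on [holomorphic_intros]:
  assumes "f holomorphic_on S"
  shows "(\<lambda>z. qfact_inf (f z) q) holomorphic_on S"
  using holomorphic_on_compose_gen[OF assms qfact_inf_holomorphic] by (simp add: o_def)

lemma tendsto_qfact_inf [tendsto_intros]:
  assumes "(f \<longlongrightarrow> c) F"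
  shows "((\<lambda>x. qfact_inf (f x) q) \<longlongrightarrow> qfact_inf c q) F"
proof -
  have "continuous_on UNIV (\<lambda>z. qfact_inf z q)"
    by (rule holomorphic_on_imp_continuous_on[OF qfact_inf_holomorphic])
  then have "isCont (\<lambda>z. qfact_inf z q) c"
    by (simp add: continuous_on_eq_continuous_at)
  then show ?thesis using assms by (rule isCont_tendsto_compose)
qed

lemma q_power_ne_1: "n > 0 \<Longrightarrow> q ^ n \<noteq> 1"
proof
  assume "n > 0" "q ^ n = 1"
  then have "norm q ^ n = 1" by (metis norm_power norm_one)
  moreover have "norm q ^ n < 1" using q1 \<open>n > 0\<close> by (simp add: power_less_one_iff)
  ultimately show False by simp
qed

text \<open>The sum \<open>f\<close> satisfies
  \<open>f w * (1 - w) = (1 - A * w) * f (w * q)\<close>; iterating moves the argument to 0, where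
  \<open>f\<close> is 1. Assuming summability instead of \<open>norm z < 1\<close> keeps terminating
  series with arbitrary \<open>z\<close> in scope.\<close>

lemma q_binomial_sum:
  fixes A z :: complex
  defines "c \<equiv> \<lambda>n. (\<Prod>k<n. 1 - A * q ^ k) / (\<Prod>k<n. 1 - q * q ^ k)"
  assumes sm: "summable (\<lambda>n. c n * z ^ n)"
  shows "(\<Sum>n. c n * z ^ n) * qfact_inf z q = qfact_inf (A * z) q"
proof (cases "z = 0")
  case True
  show ?thesis unfolding True powser_zero by (simp add: c_def)
next
  case z: False
  \<comment> \<open>A power series converging at \<open>z\<close> converges at every point of
    smaller modulus, in particular along the orbit \<open>z * q ^ N\<close>.\<close>
  have smw: "summable (\<lambda>n. c n * (z * q ^ N) ^ n)" for N
  proof (cases "N = 0")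
    case False
    have "norm (z * q ^ N) < norm z"
      using z q1 False by (simp add: norm_mult norm_power power_less_one_iff)
    then show ?thesis using powser_inside[OF sm] by blast
  qed (use sm in simp)
  have rec: "c (Suc n) * (1 - q ^ Suc n) = c n * (1 - A * q ^ n)" for n
    using q_power_ne_1[of "Suc n"] by (simp add: c_def)
  define f where "f = (\<lambda>w. \<Sum>n. c n * w ^ n)"
  have step: "f w * (1 - w) = (1 - A * w) * f (w * q)" 
    if s1: "summable (\<lambda>n. c n * w ^ n)" and s2: "summable (\<lambda>n. c n * (w * q) ^ n)" for w
  proof -
    have S: "(\<lambda>n. c n * w ^ n - c n * (w * q) ^ n) sums (f w - f (w * q))"
      unfolding f_def using s1 s2 by (intro sums_diff summable_sums)
    have "(\<lambda>n. c (Suc n) * w ^ Suc n - c (Suc n) * (w * q) ^ Suc n) sums (f w - f (w * q))"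
      using S sums_Suc_iff[of "\<lambda>n. c n * w ^ n - c n * (w * q) ^ n" "f w - f (w * q)"] by simp
    moreover have "(\<lambda>n. w * (c n * w ^ n) - w * A * (c n * (w * q) ^ n)) sums (w * f w - w * A * f (w * q))"
      unfolding f_def using s1 s2 by (intro sums_diff sums_mult summable_sums)
    moreover have "c (Suc n) * w ^ Suc n - c (Suc n) * (w * q) ^ Suc n 
       = w * (c n * w ^ n) - w * A * (c n * (w * q) ^ n)" for n
    proof -
      have "c (Suc n) * w ^ Suc n - c (Suc n) * (w * q) ^ Suc n = c (Suc n) * (1 - q ^ Suc n) * w ^ Suc n"
        by (simp add: power_mult_distrib algebra_simps)
      also have "\<dots> = w * (c n * w ^ n) - w * A * (c n * (w * q) ^ n)"
        unfolding rec by (simp add: power_mult_distrib algebra_simps)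
      finally show ?thesis .
    qed
    ultimately have "f w - f (w * q) = w * f w - w * A * f (w * q)"
      using sums_unique2 by simp
    then show ?thesis by (simp add: algebra_simps)
  qed
  have iter: "f z * (\<Prod>k<N. 1 - z * q ^ k) = (\<Prod>k<N. 1 - A * z * q ^ k) * f (z * q ^ N)" for N
  proof (induction N)
    case (Suc N)
    have "f z * (\<Prod>k<Suc N. 1 - z * q ^ k) = (f z * (\<Prod>k<N. 1 - z * q ^ k)) * (1 - z * q ^ N)"
      by simp
    also have "\<dots> = (\<Prod>k<N. 1 - A * z * q ^ k) * (f (z * q ^ N) * (1 - z * q ^ N))"
      unfolding Suc by simp
    also have "f (z * q ^ N) * (1 - z * q ^ N) = (1 - A * (z * q ^ N)) * f (z * q ^ N * q)"
      by (rule step) (use smw[of N] smw[of "Suc N"] in \<open>simp_all add: mult_ac\<close>)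
    finally show ?case by (simp add: mult_ac)
  qed simp
  have "isCont f 0"
    unfolding f_def by (rule isCont_powser[OF sm]) (use z in simp)
  moreover have "(\<lambda>N. z * q ^ N) \<longlonglongrightarrow> z * 0"
    by (intro tendsto_mult tendsto_const LIMSEQ_power_zero q1)
  ultimately have "(\<lambda>N. f (z * q ^ N)) \<longlonglongrightarrow> f 0"
    using isCont_tendsto_compose by fastforce
  moreover have "f 0 = 1" unfolding f_def powser_zero by (simp add: c_def)
  ultimately have "(\<lambda>N. (\<Prod>k<N. 1 - A * z * q ^ k) * f (z * q ^ N)) \<longlonglongrightarrow> qfact_inf (A * z) q * 1"
    by (intro tendsto_mult LIMSEQ_qfact_inf) simp
  moreover have "(\<lambda>N. f z * (\<Prod>k<N. 1 - z * q ^ k)) \<longlonglongrightarrow> f z * qfact_inf z q"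
    by (intro tendsto_mult LIMSEQ_qfact_inf tendsto_const)
  ultimately have "f z * qfact_inf z q = qfact_inf (A * z) q * 1"
    unfolding iter by (intro LIMSEQ_unique)
  then show ?thesis by (simp add: f_def)
qed

section \<open>Shifted factorials with integer index\<close>

lemma qfact_add_one:
  assumes "\<And>k::nat. k \<ge> 1 \<Longrightarrow> a \<noteq> q ^ k"
  shows "qfact a q (n + 1) = (1 - a * q powi n) * qfact a q n"
proof (cases "n \<ge> 0")
  case True
  then obtain m where m: "n = int m" by (metis nonneg_int_cases)
  then have "qfact a q (n + 1) = qfact a q (int (Suc m))" by (simp add: add.commute)
  then show ?thesis unfolding qfact_of_nat m by simp
next
  case False
  then obtain m where m: "n = - int (Suc m)" by (metis negD not_le)
  have "a / q ^ Suc m \<noteq> 1" using assms[of "Suc m"] q0 by auto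
  then have *: "1 - a / q ^ Suc m \<noteq> 0" by simp
  have "n + 1 = - int m" using m by simp
  then have "qfact a q (n + 1) = inverse (\<Prod>k=1..m. 1 - a / q ^ k)" by (simp only: qfact_neg_of_nat)
  moreover have "qfact a q n = inverse ((\<Prod>k=1..m. 1 - a / q ^ k) * (1 - a / q ^ Suc m))"
    unfolding m qfact_neg_of_nat by simp
  moreover have "a * q powi n = a / q ^ Suc m"
    unfolding m power_int_minus power_int_of_nat by (simp add: divide_inverse)
  ultimately show ?thesis using * by simp
qed

lemma qfact_0 [simp]: "qfact a q 0 = 1"
  by (simp add: qfact_def)

text \<open>The left side is invariant under \<open>n\<close> to \<open>n + 1\<close>, as the factor
  gained by \<open>qfact\<close> is the one lost by the infinite product. With
  \<open>a = - l\<close> it turns the denominators of the Laplace terms into finite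
  factorials.\<close>

lemma qfact_inf_shift:
  assumes "\<And>k::nat. k \<ge> 1 \<Longrightarrow> a \<noteq> q ^ k"
  shows "qfact a q n * qfact_inf (a * q powi n) q = qfact_inf a q"
proof (rule int_recurrence_unique[where r="\<lambda>_. 1" and g="\<lambda>_. qfact_inf a q" 
      and f="\<lambda>n. qfact a q n * qfact_inf (a * q powi n) q"])
  fix n
  show "qfact a q (n + 1) * qfact_inf (a * q powi (n + 1)) q = 1 * (qfact a q n * qfact_inf (a * q powi n) q)"
    using q0 by (simp add: qfact_add_one[OF assms] qfact_inf_step[of "a * q powi n"] power_int_add mult_ac)
qed auto

lemma qfact_ratio_tendsto_0:
  assumes "a \<noteq> 0"
  shows "(\<lambda>n. inverse (1 - a / q ^ Suc n) * c) \<longlonglongrightarrow> 0"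
proof -
  have "(\<lambda>n. q ^ Suc n) \<longlonglongrightarrow> 0"
    using LIMSEQ_power_zero[OF q1] by (rule LIMSEQ_Suc)
  then have "(\<lambda>n. q ^ Suc n / (q ^ Suc n - a) * c) \<longlonglongrightarrow> 0 / (0 - a) * c"
    by (intro tendsto_intros) (use assms in auto)
  moreover have "inverse (1 - a / q ^ Suc n) = q ^ Suc n / (q ^ Suc n - a)" for n
  proof -
    have "1 - a / q ^ Suc n = (q ^ Suc n - a) / q ^ Suc n" using q0 by (simp add: field_simps)
    then show ?thesis by simp
  qed
  ultimately show ?thesis by simp
qed

text \<open>The ratio of consecutive terms tends to 0, whatever \<open>z\<close> is; only the right
  half of the bilateral series can restrict \<open>z\<close>.\<close>

lemma summable_qfact_neg:
  assumes "a \<noteq> 0"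
  shows "summable (\<lambda>n. norm (qfact a q (- int n) * z powi (- int n)))"
proof (rule summable_ratio_tendsto_0)
  show "qfact a q (- int (Suc n)) * z powi (- int (Suc n)) =
      inverse (1 - a / q ^ Suc n) * inverse z * (qfact a q (- int n) * z powi (- int n))" for n
    unfolding qfact_neg_of_nat power_int_minus power_int_of_nat by simp
qed (rule qfact_ratio_tendsto_0[OF assms])

lemma summable_on_qfact:
  assumes "a \<noteq> 0" "norm z < 1"
  shows "(\<lambda>n. qfact a q n * z powi n) summable_on UNIV"
proof (rule summable_on_intI)
  show "summable (\<lambda>n. norm (qfact a q (int n) * z powi (int n)))"
    unfolding qfact_of_nat power_int_of_nat
    by (intro summable_geometric_series_if assms) (use LIMSEQ_qfact_inf in \<open>auto simp: convergent_def\<close>)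
qed (rule summable_qfact_neg[OF assms(1)])

lemma qfact_inf_q_nz: "qfact_inf q q \<noteq> 0"
  by (rule qfact_inf_nz[OF q1])

lemma qq_prod_nz: "(\<Prod>k<n. 1 - q * q ^ k) \<noteq> 0"
proof -
  have "q * q ^ k \<noteq> 1" for k using q_power_ne_1[of "Suc k"] by simp
  then show ?thesis by simp
qed

text \<open>Both the products and their inverses converge, the limit being nonzero. The constant
  serves as the dominating factor when \<open>M\<close> tends to infinity.\<close>

lemma qq_prod_ratio_bounded:
  "\<exists>C\<ge>0. \<forall>m n. norm ((\<Prod>k<m. 1 - q * q ^ k) / (\<Prod>k<n. 1 - q * q ^ k)) \<le> C"
proof -
  let ?s = "\<lambda>n. \<Prod>k<n. 1 - q * q ^ k"
  have 1: "convergent ?s" "convergent (\<lambda>n. inverse (?s n))"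
    using LIMSEQ_qfact_inf[of q] qfact_inf_q_nz
      tendsto_inverse[OF LIMSEQ_qfact_inf[of q] qfact_inf_q_nz]
    by (auto simp: convergent_def)
  obtain B where B: "B > 0" "\<And>n. norm (?s n) \<le> B"
    using convergent_imp_Bseq[OF 1(1)] by (auto simp: Bseq_def)
  obtain B' where B': "B' > 0" "\<And>n. norm (inverse (?s n)) \<le> B'"
    using convergent_imp_Bseq[OF 1(2)] by (auto simp: Bseq_def)
  have "norm (?s m / ?s n) \<le> B * B'" for m n
    unfolding divide_inverse norm_mult using B B' by (intro mult_mono) auto
  with B B' show ?thesis by (intro exI[of _ "B * B'"]) auto
qed

text \<open>Starting the count at index \<open>-M\<close> exposes the numerators of a
  \<open>q\<close>-binomial series with parameter \<open>a / q ^ M\<close>.\<close>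

lemma qfact_minus_shift:
  assumes "\<And>k::nat. k \<ge> 1 \<Longrightarrow> a \<noteq> q ^ k"
  shows "qfact a q (int m - int M) = qfact a q (- int M) * (\<Prod>k<m. 1 - a / q ^ M * q ^ k)"
proof (induction m)
  case (Suc m)
  have "qfact a q (int (Suc m) - int M) = qfact a q ((int m - int M) + 1)"
    by (simp add: algebra_simps)
  also have "\<dots> = (1 - a * q powi (int m - int M)) * qfact a q (int m - int M)"
    by (rule qfact_add_one[OF assms])
  also have "a * q powi (int m - int M) = a / q ^ M * q ^ m"
    using q0 by (simp add: power_int_diff)
  finally show ?case using Suc by simp
qed simp

text \<open>Writing \<open>1 - u / q ^ j\<close> as \<open>- (u / q ^ j) * (1 - q ^ j / u)\<close>
  for \<open>u = a * z\<close> and \<open>u = a\<close> turns negative powers of \<open>q\<close>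
  into positive ones; the prefactors cancel up to a power of \<open>z\<close>, which
  \<open>z powi (- int M)\<close> absorbs. The right-hand forms converge as \<open>M\<close>
  grows.\<close>

lemma qfact_reflect:
  assumes "\<And>k::nat. k \<ge> 1 \<Longrightarrow> a \<noteq> q ^ k" "a \<noteq> 0" "z \<noteq> 0"
  shows "qfact a q (- int M) * z powi (- int M) * (\<Prod>k<M. 1 - a * z / q ^ M * q ^ k) * (\<Prod>k<M. 1 - q / a * q ^ k)
    = (\<Prod>k<M. 1 - q / (a * z) * q ^ k)"
proof (induction M)
  case (Suc M)
  let ?N = "Suc M"
  have nz: "1 - a / q ^ ?N \<noteq> 0" using assms(1)[of ?N] q0 by auto
  have 1: "qfact a q (- int ?N) = qfact a q (- int M) / (1 - a / q ^ ?N)"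
    unfolding qfact_neg_of_nat by (simp add: divide_inverse)
  \<comment> \<open>The new factor enters at index 0, the others move up by one.\<close>
  have 2: "(\<Prod>k<?N. 1 - a * z / q ^ ?N * q ^ k) = (1 - a * z / q ^ ?N) * (\<Prod>k<M. 1 - a * z / q ^ M * q ^ k)"
  proof -
    have "a * z / q ^ ?N * q ^ Suc k = a * z / q ^ M * q ^ k" for k using q0 by simp
    then show ?thesis unfolding prod.lessThan_Suc_shift by simp
  qed
  have 3: "z powi (- int ?N) = z powi (- int M) / z"
    unfolding power_int_minus power_int_of_nat by (simp add: divide_inverse)
  have 4: "(1 - a * z / q ^ ?N) / z * (1 - q / a * q ^ M) / (1 - a / q ^ ?N) = 1 - q / (a * z) * q ^ M"
    using nz assms(2,3) q0 by (simp add: field_simps)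
  have "qfact a q (- int ?N) * z powi (- int ?N) * (\<Prod>k<?N. 1 - a * z / q ^ ?N * q ^ k) * (\<Prod>k<?N. 1 - q / a * q ^ k)
    = (qfact a q (- int M) * z powi (- int M) * (\<Prod>k<M. 1 - a * z / q ^ M * q ^ k) * (\<Prod>k<M. 1 - q / a * q ^ k))
      * ((1 - a * z / q ^ ?N) / z * (1 - q / a * q ^ M) / (1 - a / q ^ ?N))"
    unfolding 1 2 3 unfolding prod.lessThan_Suc times_divide_eq_left times_divide_eq_right divide_divide_eq_left 
    by (simp only: mult_ac)
  then show ?case unfolding Suc 4 by simp
qed simp

section \<open>Ramanujan's summation and the Jacobi triple product\<close>

text \<open>The denominators are multiplied out, so the identity holds at their zeros too.
  Summability is assumed rather than \<open>norm z < 1\<close>, so that terminating series, needed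
  for the triple product, are included.\<close>

lemma ramanujan_psi_sum:
  assumes a: "\<And>k::nat. k \<ge> 1 \<Longrightarrow> a \<noteq> q ^ k" "a \<noteq> 0" and z: "z \<noteq> 0"
    and sm: "(\<lambda>n. qfact a q n * z powi n) summable_on UNIV"
  shows "(\<Sum>\<^sub>\<infinity>n. qfact a q n * z powi n) * qfact_inf z q * qfact_inf (q / a) q =
    qfact_inf q q * qfact_inf (a * z) q * qfact_inf (q / (a * z)) q"
proof -
  define s where "s = (\<lambda>n. \<Prod>k<n. 1 - q * q ^ k)"
  have s_nz: "s n \<noteq> 0" for n unfolding s_def by (rule qq_prod_nz)
  have s_lim: "s \<longlonglongrightarrow> qfact_inf q q" unfolding s_def by (rule LIMSEQ_qfact_inf)
  obtain C where C: "\<And>m n. norm (s m / s n) \<le> C" "C \<ge> 0"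
    unfolding s_def using qq_prod_ratio_bounded by auto
  \<comment> \<open>This weight is \<open>1 / (q^(M+1);q)_n\<close>, read as 0 for
    \<open>n < -M\<close>. It inserts the lower parameter and tends to 1 for fixed
    \<open>n\<close>.\<close>
  define w where "w = (\<lambda>M n. if int M + n \<ge> 0 then s M / s (nat (int M + n)) else 0)"
  define T where "T = (\<lambda>M n. w M n * (qfact a q n * z powi n))"
  define g where "g = (\<lambda>n. C * norm (qfact a q n * z powi n))"
  have g: "g summable_on UNIV"
    unfolding g_def by (intro summable_on_cmult_right summable_on_iff_abs_summable_on_complex[THEN iffD1, OF sm])
  have Tg: "norm (T M n) \<le> g n" for M n
    unfolding T_def g_def norm_mult[of "w M n"] by (intro mult_right_mono) (auto simp: w_def C)
  have lim1: "(\<lambda>M. infsum (T M) UNIV) \<longlonglongrightarrow> (\<Sum>\<^sub>\<infinity>n. qfact a q n * z powi n)"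
  proof (rule infsum_dominated_convergence[OF g Tg])
    fix n :: int
    have "filterlim (\<lambda>M. nat (int M + n)) at_top at_top"
      unfolding filterlim_at_top eventually_sequentially
      by (intro allI, rule_tac x="nat (int Z - n)" in exI) auto
    then have "(\<lambda>M. s M / s (nat (int M + n))) \<longlonglongrightarrow> qfact_inf q q / qfact_inf q q"
      by (intro tendsto_divide s_lim filterlim_compose[OF s_lim] qfact_inf_q_nz)
    moreover have "eventually (\<lambda>M. s M / s (nat (int M + n)) = w M n) sequentially"
      unfolding eventually_sequentially w_def by (intro exI[of _ "nat (-n)"]) auto
    ultimately have "(\<lambda>M. w M n) \<longlonglongrightarrow> 1"
      using qfact_inf_q_nz by (simp add: tendsto_cong)
    then have "(\<lambda>M. T M n) \<longlonglongrightarrow> 1 * (qfact a q n * z powi n)"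
      unfolding T_def by (intro tendsto_mult tendsto_const)
    then show "(\<lambda>M. T M n) \<longlonglongrightarrow> qfact a q n * z powi n" by simp
  qed
  \<comment> \<open>The substitution \<open>n = m - M\<close> makes the sum one-sided, the terms
    below \<open>-M\<close> being 0; the \<open>q\<close>-binomial theorem then evaluates
    it.\<close>
  have eq: "infsum (T M) UNIV * qfact_inf z q * (\<Prod>k<M. 1 - q / a * q ^ k) =
      s M * qfact_inf (a * z) q * (\<Prod>k<M. 1 - q / (a * z) * q ^ k)" for M
  proof -
    \<comment> \<open>The term of index \<open>-M\<close>. It is nonzero, so summability passes to
      the \<open>q\<close>-binomial series by division.\<close>
    define K where "K = s M * qfact a q (- int M) * z powi (- int M)"
    define c where "c = (\<lambda>m. (\<Prod>k<m. 1 - a / q ^ M * q ^ k) / (\<Prod>k<m. 1 - q * q ^ k))"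
    have K0: "K \<noteq> 0"
      unfolding K_def qfact_neg_of_nat using s_nz z a(1) q0 by (auto simp: Suc_le_eq)
    have T: "T M (int m - int M) = K * (c m * z ^ m)" for m
      unfolding T_def w_def K_def c_def using z
      by (simp add: qfact_minus_shift[OF a(1)] power_int_diff power_int_minus s_def field_simps)
    have Tsm: "T M summable_on UNIV"
      by (rule abs_summable_summable, rule summable_on_comparison_test[OF g]) (use Tg in auto)
    have inj: "inj (\<lambda>m. int m - int M)" by (auto simp: inj_on_def)
    have "T M summable_on range (\<lambda>m. int m - int M)"
      by (rule summable_on_subset_banach[OF Tsm]) auto
    then have "(\<lambda>m. K * (c m * z ^ m)) summable_on UNIV"
      by (subst (asm) summable_on_reindex[OF inj]) (simp add: o_def T)
    then have sums: "(\<lambda>m. K * (c m * z ^ m)) sums (\<Sum>\<^sub>\<infinity>m. K * (c m * z ^ m))"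
      by (intro has_sum_imp_sums has_sum_infsum)
    then have "summable (\<lambda>m. K * (c m * z ^ m))"
      by (rule sums_summable)
    then have sm': "summable (\<lambda>m. c m * z ^ m)"
      using K0 by simp
    have "infsum (T M) UNIV = infsum (T M) (range (\<lambda>m. int m - int M))"
    proof (rule infsum_cong_neutral)
      fix n assume "n \<in> UNIV - range (\<lambda>m. int m - int M)"
      then have "int M + n < 0"
        by (auto simp: image_iff) (metis add.commute add_diff_cancel_left' nonneg_int_cases not_le)
      then show "T M n = 0" by (simp add: T_def w_def)
    qed auto
    also have "\<dots> = (\<Sum>\<^sub>\<infinity>m. K * (c m * z ^ m))"
      by (subst infsum_reindex[OF inj]) (simp add: o_def T)
    also have "\<dots> = (\<Sum>m. K * (c m * z ^ m))"
      using sums by (rule sums_unique)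
    also have "\<dots> = K * (\<Sum>m. c m * z ^ m)"
      using sm' by (rule suminf_mult)
    finally have "infsum (T M) UNIV * qfact_inf z q = K * ((\<Sum>m. c m * z ^ m) * qfact_inf z q)"
      by simp
    also have "(\<Sum>m. c m * z ^ m) * qfact_inf z q = qfact_inf (a / q ^ M * z) q"
      using q_binomial_sum[of "a / q ^ M" z] sm' unfolding c_def by simp
    also have "\<dots> = (\<Prod>k<M. 1 - a * z / q ^ M * q ^ k) * qfact_inf (a * z) q"
      using qfact_inf_split[of "a / q ^ M * z" M] q0 by simp
    finally have "infsum (T M) UNIV * qfact_inf z q * (\<Prod>k<M. 1 - q / a * q ^ k) =
      s M * qfact_inf (a * z) q * (qfact a q (- int M) * z powi (- int M) * 
        (\<Prod>k<M. 1 - a * z / q ^ M * q ^ k) * (\<Prod>k<M. 1 - q / a * q ^ k))"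
      by (simp add: K_def)
    then show ?thesis by (simp only: qfact_reflect[OF a z, of M])
  qed
  have "(\<lambda>M. infsum (T M) UNIV * qfact_inf z q * (\<Prod>k<M. 1 - q / a * q ^ k)) \<longlonglongrightarrow>
     (\<Sum>\<^sub>\<infinity>n. qfact a q n * z powi n) * qfact_inf z q * qfact_inf (q / a) q"
    by (intro tendsto_mult tendsto_const lim1 LIMSEQ_qfact_inf)
  moreover have "(\<lambda>M. infsum (T M) UNIV * qfact_inf z q * (\<Prod>k<M. 1 - q / a * q ^ k)) \<longlonglongrightarrow>
      qfact_inf q q * qfact_inf (a * z) q * qfact_inf (q / (a * z)) q"
    unfolding eq by (intro tendsto_mult tendsto_const s_lim LIMSEQ_qfact_inf)
  ultimately show ?thesis by (rule LIMSEQ_unique)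
qed

lemma summable_on_theta:
  assumes z: "z \<noteq> 0"
  shows "(\<lambda>n::int. q powi (n * (n - 1) div 2) * z powi n) summable_on UNIV"
proof -
  define f where "f = (\<lambda>n::int. q powi (n * (n - 1) div 2) * z powi n)"
  have f_Suc: "f (n + 1) = q powi n * z * f n" for n
    unfolding f_def using triangle_exponent_Suc[of n] q0 z by (simp add: power_int_add mult_ac)
  have "summable (\<lambda>n. norm (f (int n)))"
  proof (rule summable_ratio_tendsto_0)
    show "f (int (Suc n)) = q ^ n * z * f (int n)" for n
      using f_Suc[of "int n"] by (simp add: add.commute)
    show "(\<lambda>n. q ^ n * z) \<longlonglongrightarrow> 0"
      using tendsto_mult[OF LIMSEQ_power_zero[OF q1] tendsto_const] by simp
  qed
  moreover have "summable (\<lambda>n. norm (f (- int n)))"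
  proof (rule summable_ratio_tendsto_0)
    show "f (- int (Suc n)) = q ^ Suc n / z * f (- int n)" for n
    proof -
      have "f (- int (Suc n) + 1) = q powi (- int (Suc n)) * z * f (- int (Suc n))"
        by (rule f_Suc)
      then have "f (- int n) = inverse (q ^ Suc n) * z * f (- int (Suc n))"
        unfolding power_int_minus power_int_of_nat by simp
      then show ?thesis using q0 z by (simp add: field_simps)
    qed
    have "(\<lambda>n. q ^ Suc n) \<longlonglongrightarrow> 0"
      using LIMSEQ_power_zero[OF q1] by (rule LIMSEQ_Suc)
    then show "(\<lambda>n. q ^ Suc n / z) \<longlonglongrightarrow> 0" by (rule tendsto_divide_zero)
  qed
  ultimately have "f summable_on UNIV" by (rule summable_on_intI)
  then show ?thesis unfolding f_def .
qed

lemma inverse_q_power_ne_q_power: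
  assumes "k \<ge> 1"
  shows "1 / q ^ M \<noteq> q ^ k"
proof
  assume "1 / q ^ M = q ^ k"
  then have "q ^ (k + M) = 1" using q0 by (simp add: power_add field_simps)
  then show False using q_power_ne_1[of "k + M"] assms by simp
qed

text \<open>Both sides satisfy the recurrence with factor \<open>q powi n - q ^ M\<close>. The
  identity exhibits the terms of Ramanujan's series for \<open>a = 1 / q ^ M\<close> as theta terms
  with a weight tending to 1.\<close>

lemma qfact_inverse_power:
  fixes n :: int
  defines "s \<equiv> \<lambda>n. \<Prod>k<n. 1 - q * q ^ k"
  shows "qfact (1 / q ^ M) q n * (- (q ^ M)) powi n =
    q powi (n * (n - 1) div 2) * (if n \<le> int M then s M / s (nat (int M - n)) else 0)"
proof (rule int_recurrence_unique[where r="\<lambda>n. q powi n - q ^ M" and n=n and 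
      f="\<lambda>n. qfact (1 / q ^ M) q n * (- (q ^ M)) powi n"])
  note ne = inverse_q_power_ne_q_power
  show "qfact (1 / q ^ M) q (n + 1) * (- (q ^ M)) powi (n + 1) =
      (q powi n - q ^ M) * (qfact (1 / q ^ M) q n * (- (q ^ M)) powi n)" for n
  proof -
    have "(1 - 1 / q ^ M * q powi n) * - (q ^ M) = q powi n - q ^ M" using q0 by (simp add: field_simps)
    moreover have "(- (q ^ M)) powi (n + 1) = (- (q ^ M)) powi n * - (q ^ M)"
      using q0 by (simp add: power_int_add)
    moreover have "qfact (1 / q ^ M) q (n + 1) = (1 - 1 / q ^ M * q powi n) * qfact (1 / q ^ M) q n"
      by (rule qfact_add_one) (rule ne)
    moreover have "A * B * (C * D) = A * D * (B * C)" for A B C D :: complex by simp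
    ultimately show ?thesis by (simp only:)
  qed
  show "q powi ((n + 1) * (n + 1 - 1) div 2) * (if n + 1 \<le> int M then s M / s (nat (int M - (n + 1))) else 0)
     = (q powi n - q ^ M) * (q powi (n * (n - 1) div 2) * (if n \<le> int M then s M / s (nat (int M - n)) else 0))" for n
  proof -
    \<comment> \<open>At \<open>n = M\<close> the recurrence factor vanishes, exactly where the
      weight drops to 0.\<close>
    consider "n < int M" | "n = int M" | "n > int M" by linarith
    then show ?thesis
    proof cases
      case 1
      define j where "j = nat (int M - (n + 1))"
      have j: "nat (int M - n) = Suc j" "int M = n + int (Suc j)" using 1 by (auto simp: j_def)
      have "q ^ M = q powi (int M)" by simp
      also have "\<dots> = q powi n * q ^ Suc j" 
        unfolding j(2) using q0 by (subst power_int_add) (auto simp del: of_nat_Suc)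
      finally have qM: "q ^ M = q powi n * q ^ Suc j" .
      have "s (Suc j) = s j * (1 - q ^ Suc j)" "s j \<noteq> 0" "1 - q ^ Suc j \<noteq> 0"
        unfolding s_def using qq_prod_nz q_power_ne_1[of "Suc j"] by auto
      then have E: "s M / s j = (1 - q ^ Suc j) * (s M / s (Suc j))" by simp
      have E2: "q powi ((n + 1) * (n + 1 - 1) div 2) = q powi (n * (n - 1) div 2) * q powi n"
        using triangle_exponent_Suc[of n] q0 by (simp add: power_int_add)
      have le: "n + 1 \<le> int M" "n \<le> int M" using 1 by auto
      have "A * B * ((1 - Q) * r) = (B - B * Q) * (A * r)" for A B Q r :: complex
        by (simp add: algebra_simps)
      then show ?thesis
        by (simp only: qM j(1) j_def[symmetric] E E2 le if_True)
    qed auto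
  qed
  show "q powi n - q ^ M \<noteq> 0" if "n < 0" for n
  proof
    assume "q powi n - q ^ M = 0"
    moreover obtain j where j: "n = - int (Suc j)" using \<open>n < 0\<close> by (metis negD)
    ultimately have "inverse (q ^ Suc j) = q ^ M"
      by (simp only: power_int_minus power_int_of_nat) simp
    then have "q ^ (M + Suc j) = 1" using q0 by (simp add: power_add field_simps)
    then show False using q_power_ne_1[of "M + Suc j"] by simp
  qed
  show "qfact (1 / q ^ M) q 0 * (- (q ^ M)) powi 0 =
    q powi (0 * (0 - 1) div 2) * (if 0 \<le> int M then s M / s (nat (int M - 0)) else 0)"
    using qq_prod_nz by (simp add: s_def)
qed

theorem jacobi_triple_product:
  assumes z: "z \<noteq> 0"
  shows "theta q z = qfact_inf q q * qfact_inf (- z) q * qfact_inf (- q / z) q"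
proof -
  define s where "s = (\<lambda>n. \<Prod>k<n. 1 - q * q ^ k)"
  have s_lim: "s \<longlonglongrightarrow> qfact_inf q q" unfolding s_def by (rule LIMSEQ_qfact_inf)
  obtain C where C: "\<And>m n. norm (s m / s n) \<le> C" "C \<ge> 0"
    unfolding s_def using qq_prod_ratio_bounded by auto
  define w where "w = (\<lambda>M n. if n \<le> int M then s M / s (nat (int M - n)) else 0)"
  define t where "t = (\<lambda>n::int. q powi (n * (n - 1) div 2) * z powi n)"
  define T where "T = (\<lambda>M n. w M n * t n)"
  define g where "g = (\<lambda>n. C * norm (t n))"
  have T_eq: "T M n = qfact (1 / q ^ M) q n * (- z * q ^ M) powi n" for M n
  proof -
    have "qfact (1 / q ^ M) q n * (- z * q ^ M) powi n = qfact (1 / q ^ M) q n * (- (q ^ M)) powi n * z powi n"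
      by (simp flip: power_int_mult_distrib add: mult_ac)
    then show ?thesis
      unfolding qfact_inverse_power T_def w_def t_def s_def by (simp add: mult_ac)
  qed
  have g: "g summable_on UNIV"
    unfolding g_def t_def by (intro summable_on_cmult_right summable_on_iff_abs_summable_on_complex[THEN iffD1] summable_on_theta z)
  have Tg: "norm (T M n) \<le> g n" for M n
    unfolding T_def g_def norm_mult[of "w M n"] by (intro mult_right_mono) (auto simp: w_def C)
  have lim1: "(\<lambda>M. infsum (T M) UNIV) \<longlonglongrightarrow> infsum t UNIV"
  proof (rule infsum_dominated_convergence[OF g Tg])
    fix n :: int
    have "filterlim (\<lambda>M. nat (int M - n)) at_top at_top"
      unfolding filterlim_at_top eventually_sequentially
      by (intro allI, rule_tac x="nat (int Z + n)" in exI) auto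
    then have "(\<lambda>M. s M / s (nat (int M - n))) \<longlonglongrightarrow> qfact_inf q q / qfact_inf q q"
      by (intro tendsto_divide s_lim filterlim_compose[OF s_lim] qfact_inf_q_nz)
    moreover have "eventually (\<lambda>M. s M / s (nat (int M - n)) = w M n) sequentially"
      unfolding eventually_sequentially w_def by (intro exI[of _ "nat n"]) auto
    ultimately have "(\<lambda>M. w M n) \<longlonglongrightarrow> 1"
      using qfact_inf_q_nz by (simp add: tendsto_cong)
    then have "(\<lambda>M. T M n) \<longlonglongrightarrow> 1 * t n"
      unfolding T_def by (intro tendsto_mult tendsto_const)
    then show "(\<lambda>M. T M n) \<longlonglongrightarrow> t n" by simp
  qed
  \<comment> \<open>Ramanujan's sum with parameter \<open>1 / q ^ M\<close> and argument
    \<open>- z * q ^ M\<close>: their product \<open>- z\<close> is independent of \<open>M\<close>,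
    while the two products containing \<open>q ^ M\<close> tend to 1.\<close>
  have eq: "infsum (T M) UNIV * qfact_inf (- z * q ^ M) q * qfact_inf (q * q ^ M) q =
    qfact_inf q q * qfact_inf (- z) q * qfact_inf (- q / z) q" for M
  proof -
    note ne = inverse_q_power_ne_q_power
    have "T M summable_on UNIV"
      by (rule abs_summable_summable, rule summable_on_comparison_test[OF g]) (use Tg in auto)
    then have sm: "(\<lambda>n. qfact (1 / q ^ M) q n * (- z * q ^ M) powi n) summable_on UNIV"
      by (simp add: T_eq[abs_def])
    have Tf: "T M = (\<lambda>n. qfact (1 / q ^ M) q n * (- z * q ^ M) powi n)"
      by (rule ext) (rule T_eq)
    show ?thesis
      using ramanujan_psi_sum[OF ne _ _ sm] q0 z unfolding Tf by (simp add: field_simps)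
  qed
  have "(\<lambda>M. infsum (T M) UNIV * qfact_inf (- z * q ^ M) q * qfact_inf (q * q ^ M) q) \<longlonglongrightarrow>
     infsum t UNIV * qfact_inf (- z * 0) q * qfact_inf (q * 0) q"
    by (intro tendsto_mult tendsto_const lim1 tendsto_qfact_inf LIMSEQ_power_zero q1)
  then have "(\<lambda>M. qfact_inf q q * qfact_inf (- z) q * qfact_inf (- q / z) q) \<longlonglongrightarrow> infsum t UNIV"
    unfolding eq by (simp add: qfact_inf_0)
  then have "qfact_inf q q * qfact_inf (- z) q * qfact_inf (- q / z) q = infsum t UNIV"
    by (rule LIMSEQ_unique[OF tendsto_const])
  then show ?thesis by (simp add: theta_def t_def)
qed

lemma q_spiral_shift: "w * q powi k \<in> q_spiral c q \<longleftrightarrow> w \<in> q_spiral c q"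
proof -
  have *: "w * q powi k \<in> q_spiral c q" if "w \<in> q_spiral c q" for w k
  proof -
    obtain j where "w = c * q powi j" using \<open>w \<in> q_spiral c q\<close> by (auto simp: q_spiral_def)
    then have "w * q powi k = c * q powi (j + k)" using q0 by (simp add: power_int_add)
    then show ?thesis unfolding q_spiral_def by blast
  qed
  have inv: "w * q powi k * q powi (- k) = w" using q0 by (simp add: power_int_minus)
  show ?thesis using *[of w k] *[of "w * q powi k" "- k"] unfolding inv by blast
qed

section \<open>Zeros and quasi-periodicity of theta\<close>

text \<open>Of the two products with variable argument, one vanishes at \<open>- (q powi j)\<close>
  for \<open>j <= 0\<close> and the other for \<open>j > 0\<close>; together they fill the
  spiral.\<close>

lemma theta_eq_0_iff:
  assumes "w \<noteq> 0"
  shows "theta q w = 0 \<longleftrightarrow> w \<in> q_spiral (-1) q"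
proof
  assume "theta q w = 0"
  then consider k where "- w * q ^ k = 1" | k where "- q / w * q ^ k = 1"
    unfolding jacobi_triple_product[OF assms] using qfact_inf_q_nz
    by (auto simp: qfact_inf_eq_0_iff)
  then show "w \<in> q_spiral (-1) q"
  proof cases
    case 1
    have "w * q powi (int k) = - (- w * q ^ k)" by simp
    also have "\<dots> = -1 * q powi 0" by (simp only: 1) simp
    finally have "w * q powi (int k) = -1 * q powi 0" .
    then have "w * q powi (int k) \<in> q_spiral (-1) q" unfolding q_spiral_def by blast
    then show ?thesis by (simp only: q_spiral_shift)
  next
    case 2
    then have "w = - (q ^ Suc k)" using assms by (simp add: field_simps)
    then have "w = -1 * q powi (int (Suc k))" unfolding power_int_of_nat by simp
    then show ?thesis unfolding q_spiral_def by blast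
  qed
next
  assume "w \<in> q_spiral (-1) q"
  then obtain j where j: "w = - (q powi j)" by (auto simp: q_spiral_def)
  show "theta q w = 0"
  proof (cases "j > 0")
    case True
    then obtain k where k: "j = int (Suc k)" by (metis pos_int_cases Suc_pred of_nat_0_less_iff)
    have "- q / w * q ^ k = 1" using q0 by (simp add: j k field_simps del: of_nat_Suc)
    then show ?thesis 
      unfolding jacobi_triple_product[OF assms] using qfact_inf_eq_0_iff by auto
  next
    case False
    then obtain k where k: "j = - int k" by (metis not_less nonneg_int_cases add.inverse_inverse neg_0_le_iff_le)
    have "- w * q ^ k = 1" using q0 by (simp add: j k power_int_minus)
    then show ?thesis 
      unfolding jacobi_triple_product[OF assms] using qfact_inf_eq_0_iff by auto
  qed
qed

lemma theta_holomorphic_on [holomorphic_intros]: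
  assumes "f holomorphic_on S" "\<And>x. x \<in> S \<Longrightarrow> f x \<noteq> 0"
  shows "(\<lambda>x. theta q (f x)) holomorphic_on S"
proof -
  have "(\<lambda>x. qfact_inf q q * qfact_inf (- f x) q * qfact_inf (- q / f x) q) holomorphic_on S"
    using assms by (intro holomorphic_intros qfact_inf_holomorphic_on)
  then show ?thesis
    by (rule holomorphic_transform) (use assms(2) jacobi_triple_product in auto)
qed

text \<open>In the triple product one factor \<open>1 + w\<close> is lost and one factor
  \<open>1 + 1 / w\<close> is gained; their quotient is \<open>1 / w\<close>.\<close>

lemma theta_q_times:
  assumes "w \<noteq> 0"
  shows "theta q (q * w) = theta q w / w"
proof -
  have 1: "qfact_inf (- w) q = (1 + w) * qfact_inf (- (q * w)) q"
    using qfact_inf_step[of "- w"] by simp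
  have 2: "qfact_inf (- q / (q * w)) q = (1 + 1 / w) * qfact_inf (- q / w) q"
    using qfact_inf_step[of "- 1 / w"] q0 by simp
  have "q * w \<noteq> 0" using assms q0 by simp
  then show ?thesis
    unfolding jacobi_triple_product[OF assms] jacobi_triple_product[OF \<open>q * w \<noteq> 0\<close>] 1 2
    using assms by (simp add: field_simps)
qed

text \<open>The substitution interchanges the two products with variable argument. It converts the
  Laplace kernel's \<open>l / x\<close> into the \<open>q * x / l\<close> of the final
  formula.\<close>

lemma theta_reflect:
  assumes "w \<noteq> 0"
  shows "theta q (q / w) = theta q w"
proof -
  have "q / w \<noteq> 0" using assms q0 by simp
  then show ?thesis
    unfolding jacobi_triple_product[OF assms] jacobi_triple_product[OF \<open>q / w \<noteq> 0\<close>]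
    using q0 assms by simp
qed

text \<open>The triangular powers of \<open>q\<close> from numerator and denominator cancel, so only
  a geometric factor survives. This is why the Laplace series is again of Ramanujan's type.\<close>

lemma theta_quotient_shift:
  assumes "u \<noteq> 0" "v \<noteq> 0"
  shows "theta q (u * q powi n) / theta q (v * q powi n) = (v / u) powi n * (theta q u / theta q v)"
proof (rule int_recurrence_unique[where r="\<lambda>_. v / u" and n=n])
  fix n
  have "u * q powi n \<noteq> 0" "v * q powi n \<noteq> 0" using assms q0 by auto
  note * = this[THEN theta_q_times]
  have **: "theta q (u * q powi (n + 1)) = theta q (q * (u * q powi n))"
    "theta q (v * q powi (n + 1)) = theta q (q * (v * q powi n))"
    using q0 by (simp_all add: power_int_add mult_ac)
  show "theta q (u * q powi (n + 1)) / theta q (v * q powi (n + 1)) =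
      v / u * (theta q (u * q powi n) / theta q (v * q powi n))"
    unfolding ** * using assms q0 by (simp add: field_simps)
  show "(v / u) powi (n + 1) * (theta q u / theta q v) = v / u * ((v / u) powi n * (theta q u / theta q v))"
    using assms by (subst power_int_add) auto
qed (use assms in auto)

section \<open>The Borel and Laplace transforms\<close>

text \<open>The \<open>q\<close>-binomial theorem with \<open>A = 0\<close> on the unit disc, then
  continuation; at the poles both sides are 0.\<close>

lemma phi_1_0_eq: "phi_1_0 q z = 1 / qfact_inf z q"
  unfolding phi_1_0_def
proof (rule continued_sum_eq[where V="ball 0 1"])
  show "(\<lambda>z. qfact_inf z q) holomorphic_on UNIV" by (rule qfact_inf_holomorphic)
  show "qfact_inf w q \<noteq> 0" if "w \<in> ball 0 1" for w
    using that by (intro qfact_inf_nz) simp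
  show "(\<lambda>n::nat. w ^ n / qfact q q (int n)) summable_on UNIV" if "w \<in> ball 0 1" for w
  proof -
    have "convergent (\<lambda>n. inverse (qfact q q (int n)))"
      unfolding qfact_of_nat convergent_def
      using tendsto_inverse[OF LIMSEQ_qfact_inf qfact_inf_q_nz] by blast
    then have "summable (\<lambda>n. norm (inverse (qfact q q (int n)) * w ^ n))"
      using that by (intro summable_geometric_series_if) auto
    then show ?thesis
      by (intro norm_summable_imp_summable_on) (simp only: divide_inverse mult.commute)
  qed
  show sum: "(\<Sum>\<^sub>\<infinity>n::nat. w ^ n / qfact q q (int n)) * qfact_inf w q = 1" 
    if sm: "(\<lambda>n::nat. w ^ n / qfact q q (int n)) summable_on UNIV" for w
  proof -
    have *: "w ^ n / qfact q q (int n) = (\<Prod>k<n. 1 - 0 * q ^ k) / (\<Prod>k<n. 1 - q * q ^ k) * w ^ n" for n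
      unfolding qfact_of_nat by simp
    have "(\<lambda>n::nat. w ^ n / qfact q q (int n)) sums (\<Sum>\<^sub>\<infinity>n::nat. w ^ n / qfact q q (int n))"
      using sm by (intro has_sum_imp_sums has_sum_infsum)
    then have "summable (\<lambda>n::nat. w ^ n / qfact q q (int n))" 
      "(\<Sum>\<^sub>\<infinity>n::nat. w ^ n / qfact q q (int n)) = (\<Sum>n::nat. w ^ n / qfact q q (int n))"
      by (simp_all add: sums_iff)
    then show ?thesis
      using q_binomial_sum[of 0 w] qfact_inf_0 unfolding * by simp
  qed
  \<comment> \<open>Vacuous: convergence at a zero of the denominator would give
    \<open>0 = 1\<close>.\<close>
  show "isCont (\<lambda>w. \<Sum>\<^sub>\<infinity>n::nat. w ^ n / qfact q q (int n)) w \<and> 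
    (\<forall>\<^sub>F u in at w. (\<lambda>n::nat. u ^ n / qfact q q (int n)) summable_on UNIV)"
    if "(\<lambda>n::nat. w ^ n / qfact q q (int n)) summable_on UNIV" "qfact_inf w q = 0" for w
    using sum[OF that(1)] that(2) by simp
qed auto

lemma summable_on_qfact_terminating:
  assumes "a * q ^ m = 1" "a \<noteq> 0"
  shows "(\<lambda>n. qfact a q n * z powi n) summable_on UNIV"
proof (rule summable_on_intI)
  have "qfact a q (int n) = 0" if "n > m" for n
    unfolding qfact_of_nat using that assms by (intro prod_zero) (auto intro!: bexI[of _ m])
  then show "summable (\<lambda>n. norm (qfact a q (int n) * z powi (int n)))"
    by (intro summable_finite[of "{..m}"]) auto
qed (rule summable_qfact_neg[OF assms(2)])

lemma qfact_inf_q_divide_nz: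
  assumes "a \<noteq> 0" "\<And>k::nat. k \<ge> 1 \<Longrightarrow> a \<noteq> q ^ k"
  shows "qfact_inf (q / a) q \<noteq> 0"
proof
  assume "qfact_inf (q / a) q = 0"
  then obtain k where "q / a * q ^ k = 1" using qfact_inf_eq_0_iff by blast
  then show False using assms(2)[of "Suc k"] assms(1) by (simp add: field_simps)
qed

text \<open>The Borel factor cancels the power of \<open>q\<close> in \<open>psi_1_0\<close>,
  leaving Ramanujan's series at \<open>- z\<close>. Compared with the form having
  \<open>theta q z\<close> below, the product \<open>qfact_inf (- q / z) q\<close> is already
  cancelled.\<close>

lemma q_borel_psi_1_0_eq:
  assumes a: "\<And>k::nat. k \<ge> 1 \<Longrightarrow> a \<noteq> q ^ k" "a \<noteq> 0" and z: "z \<noteq> 0" "qfact_inf (- z) q \<noteq> 0"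
  shows "q_borel q (psi_1_0 a q) z = theta q (a * z) / (qfact_inf (- z) q * qfact_inf (q / a) q)"
proof -
  note nz = qfact_inf_q_divide_nz[OF a(2,1)]
  define t where "t = (\<lambda>n w. psi_1_0 a q n * q powi (n * (n - 1) div 2) * w powi n)"
  have t: "t n w = qfact a q n * (- w) powi n" for n w
  proof -
    have "t n w = qfact a q n * ((-1) powi n * w powi n) * (q powi (- (n * (n - 1) div 2)) * q powi (n * (n - 1) div 2))"
      unfolding t_def psi_1_0_def by (simp only: mult_ac)
    also have "q powi (- (n * (n - 1) div 2)) * q powi (n * (n - 1) div 2) = 1"
      using q0 by (simp add: power_int_minus)
    also have "(-1) powi n * w powi n = (- w) powi n"
      by (simp flip: power_int_mult_distrib)
    finally show ?thesis by simp
  qed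
  have sum: "(\<Sum>\<^sub>\<infinity>n. t n w) * (qfact_inf (- w) q * qfact_inf (q / a) q) = theta q (a * w)"
    if "w \<noteq> 0" "(\<lambda>n. t n w) summable_on UNIV" for w
    using ramanujan_psi_sum[OF a, of "- w"] jacobi_triple_product[of "a * w"] a(2) that
    unfolding t by (simp add: mult_ac)
  have "continued_sum (- {0}) t z = theta q (a * z) / (qfact_inf (- z) q * qfact_inf (q / a) q)"
  proof (rule continued_sum_eq[where V="ball 0 1 - {0}"])
    show "connected (- {0 :: complex})" by (rule connected_punctured_universe) simp
    show "(\<lambda>w. theta q (a * w)) holomorphic_on - {0}"
      using a by (intro holomorphic_intros) auto
    show "(\<lambda>w. qfact_inf (- w) q * qfact_inf (q / a) q) holomorphic_on - {0}"
      by (intro holomorphic_intros qfact_inf_holomorphic_on)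
    have "(1/2 :: complex) \<in> ball 0 1 - {0}" by simp
    then show "ball 0 1 - {0 :: complex} \<noteq> {}" by blast
    fix w :: complex
    show "qfact_inf (- w) q * qfact_inf (q / a) q \<noteq> 0" "(\<lambda>n. t n w) summable_on UNIV"
      if "w \<in> ball 0 1 - {0}"
      using that qfact_inf_nz[of "- w"] nz summable_on_qfact[OF a(2), of "- w"]
      by (auto simp: t)
    assume w: "w \<in> - {0}" and sm: "(\<lambda>n. t n w) summable_on UNIV"
    show "(\<Sum>\<^sub>\<infinity>n. t n w) * (qfact_inf (- w) q * qfact_inf (q / a) q) = theta q (a * w)"
      using sum w sm by simp
    assume B0: "qfact_inf (- w) q * qfact_inf (q / a) q = 0"
    \<comment> \<open>Here the pole at \<open>w\<close> is removable, which happens only if \<open>a\<close> is a power of \<open>1 / q\<close>; then the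
      series terminates on the right and converges everywhere.\<close>
    then obtain k where k: "- w * q ^ k = 1" using nz qfact_inf_eq_0_iff by auto
    have "theta q (a * w) = 0" using sum w sm B0 by (metis ComplD insertI1 mult_zero_right)
    then have "a * w \<in> q_spiral (-1) q" using a(2) w by (subst (asm) theta_eq_0_iff) auto
    then have "a * w * q powi (int k) \<in> q_spiral (-1) q" by (simp only: q_spiral_shift)
    moreover have "a * w * q powi (int k) = - a * (- w * q ^ k)" by simp
    ultimately have "- a \<in> q_spiral (-1) q" by (simp only: k mult_1_right)
    then obtain j where j: "a = q powi j" by (auto simp: q_spiral_def)
    have "j \<le> 0"
    proof (rule ccontr)
      assume "\<not> j \<le> 0"
      then have "a = q ^ nat j" "1 \<le> nat j" by (simp_all add: j power_int_def)
      then show False using a(1) by blast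
    qed
    then have "a * q ^ nat (- j) = 1"
      using q0 by (simp add: j power_int_def field_simps)
    note all = summable_on_qfact_terminating[OF this a(2)]
    have "isCont (\<lambda>w. \<Sum>\<^sub>\<infinity>n. qfact a q n * w powi n) (- w)"
      by (rule isCont_laurent_sum) (use all w in auto)
    then have "isCont (\<lambda>w. \<Sum>\<^sub>\<infinity>n. qfact a q n * (- w) powi n) w"
      by (rule isCont_o2[rotated]) auto
    then show "isCont (\<lambda>w. \<Sum>\<^sub>\<infinity>n. t n w) w \<and> (\<forall>\<^sub>F u in at w. (\<lambda>n. t n u) summable_on UNIV)"
      using all by (simp add: t)
  qed (use z nz in auto)
  then show ?thesis by (simp add: q_borel_def t_def)
qed

text \<open>Ramanujan's sum with parameter \<open>- l\<close> and argument
  \<open>1 / (a * x)\<close>, whose numerator products combine to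
  \<open>theta q (l / (a * x))\<close>. That \<open>l\<close> avoids the spiral keeps the points
  \<open>l * q powi n\<close> off the zeros of the Borel denominator and makes \<open>- l\<close> an
  admissible parameter.\<close>

lemma q_laplace_q_borel_psi_1_0:
  assumes a: "a \<noteq> 0" "\<And>k::nat. k \<ge> 1 \<Longrightarrow> a \<noteq> q ^ k"
    and l: "l \<noteq> 0" "l \<notin> q_spiral (-1) q"
    and x: "x \<noteq> 0" "x \<notin> q_spiral (- l) q"
  shows "q_laplace q l (q_borel q (psi_1_0 a q)) x =
    theta q (a * l) * theta q (l / (a * x)) / 
    (qfact_inf (q / a) q * qfact_inf (- l) q * qfact_inf (- q / l) q * theta q (l / x) * qfact_inf (1 / (a * x)) q)"
proof -
  define E where "E = - {0} - q_spiral (- l) q"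
  define t where "t = (\<lambda>(n::int) x. q_borel q (psi_1_0 a q) (l * q powi n) / theta q (l * q powi n / x))"
  note qa = qfact_inf_q_divide_nz[OF a]
  have th: "theta q (l * q powi n) \<noteq> 0" for n
    using l q0 by (subst theta_eq_0_iff) (auto simp: q_spiral_shift)
  have l_nz: "qfact_inf (- (l * q powi n)) q \<noteq> 0" for n
    using th[of n] l q0 by (subst (asm) jacobi_triple_product) auto
  have l_nz0: "qfact_inf (- l) q \<noteq> 0" "qfact_inf (- q / l) q \<noteq> 0"
    using th[of 0] l by (auto simp: jacobi_triple_product)
  have ml: "- l \<noteq> q ^ k" for k
  proof
    assume "- l = q ^ k"
    then have "l = - (q ^ k)" by (metis minus_minus)
    then have "l = -1 * q powi (int k)" by simp
    then show False using l(2) unfolding q_spiral_def by blast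
  qed
  have E0: "w \<noteq> 0" if "w \<in> E" for w using that by (auto simp: E_def)
  have thE: "theta q (l / w) = 0 \<longleftrightarrow> w \<in> q_spiral (- l) q" if "w \<noteq> 0" for w
  proof -
    have "theta q (l / w) = 0 \<longleftrightarrow> l / w \<in> q_spiral (-1) q"
      using that l by (intro theta_eq_0_iff) auto
    also have "\<dots> \<longleftrightarrow> (\<exists>k. l / w = - (q powi k))" by (auto simp: q_spiral_def)
    also have "\<dots> \<longleftrightarrow> (\<exists>k. w = - l * q powi (- k))"
    proof -
      have "l / w = - (q powi k) \<longleftrightarrow> w = - l * q powi (- k)" for k
        using that l q0 by (simp add: power_int_minus field_simps) (metis minus_minus)
      then show ?thesis by blast
    qed
    also have "\<dots> \<longleftrightarrow> w \<in> q_spiral (- l) q"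
      unfolding q_spiral_def by (auto, metis minus_minus)
    finally show ?thesis .
  qed
  \<comment> \<open>Describing \<open>E\<close> as a nonvanishing set of a continuous function gives
    openness.\<close>
  have E_eq: "E = {w \<in> - {0}. theta q (l / w) \<in> - {0}}"
    using thE by (auto simp: E_def)
  have th_hol: "(\<lambda>w. theta q (l / w)) holomorphic_on - {0}"
    using l by (intro holomorphic_intros) auto
  have openE: "open E"
  proof -
    have "open (- {0} \<inter> (\<lambda>w. theta q (l / w)) -` (- {0}))"
      by (intro continuous_open_preimage holomorphic_on_imp_continuous_on th_hol) auto
    moreover have "E = - {0} \<inter> (\<lambda>w. theta q (l / w)) -` (- {0})" by (auto simp: E_eq)
    ultimately show ?thesis by (simp only:)
  qed
  have connE: "connected E"
    unfolding E_def using connected_open_diff_countable[of "- {0 :: complex}" "q_spiral (- l) q"]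
    by (simp add: countable_q_spiral connected_punctured_universe open_Compl)
  have xE: "x \<in> E" using x by (simp add: E_def)
  \<comment> \<open>The part of the Laplace term that does not depend on \<open>n\<close>.\<close>
  define K where "K = (\<lambda>w. theta q (a * l) / (theta q (l / w) * qfact_inf (q / a) q * qfact_inf (- l) q))"
  have t: "t n w = K w * (qfact (- l) q n * (1 / (a * w)) powi n)" if "w \<in> E" for n w
  proof -
    have "t n w = theta q (a * l * q powi n) / (qfact_inf (- (l * q powi n)) q * qfact_inf (q / a) q)
       / theta q (l / w * q powi n)"
      unfolding t_def using l q0 l_nz
      by (subst q_borel_psi_1_0_eq[OF a(2,1)]) (auto simp: mult_ac)
    also have "\<dots> = (theta q (a * l * q powi n) / theta q (l / w * q powi n)) /
        (qfact_inf (- (l * q powi n)) q * qfact_inf (q / a) q)" by simp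
    also have "theta q (a * l * q powi n) / theta q (l / w * q powi n) =
        (l / w / (a * l)) powi n * (theta q (a * l) / theta q (l / w))"
      using a l E0[OF that] by (intro theta_quotient_shift) auto
    also have "l / w / (a * l) = 1 / (a * w)" using l by simp
    finally have "t n w = (1 / (a * w)) powi n * (theta q (a * l) / theta q (l / w)) / qfact_inf (q / a) q *
        (1 / qfact_inf (- (l * q powi n)) q)" by simp
    also have "1 / qfact_inf (- (l * q powi n)) q = qfact (- l) q n / qfact_inf (- l) q"
      using qfact_inf_shift[OF ml, of n] l_nz[of n] l_nz0 by (simp add: field_simps)
    finally show ?thesis by (simp add: K_def)
  qed
  \<comment> \<open>A zero of the last denominator factor puts \<open>l / (a * w)\<close> on the
    orbit of \<open>l\<close>, which theta avoids: no \<open>0 / 0\<close> arises from these two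
    factors.\<close>
  have lz: "theta q (l / (a * w)) \<noteq> 0" if "w \<in> E" "qfact_inf (1 / (a * w)) q = 0" for w
  proof -
    obtain k where k: "1 / (a * w) * q ^ k = 1" using \<open>qfact_inf (1 / (a * w)) q = 0\<close> qfact_inf_eq_0_iff by blast
    have aw: "a * w \<noteq> 0" using a E0[OF that(1)] by simp
    then have "a * w = q ^ k" using k by (simp add: field_simps)
    then have "l / (a * w) = l * q powi (- int k)" by (simp add: power_int_minus divide_inverse)
    then show ?thesis using th[of "- int k"] by simp
  qed
  have "continued_sum E t x = theta q (a * l) * theta q (l / (a * x)) / 
    (qfact_inf (q / a) q * qfact_inf (- l) q * qfact_inf (- q / l) q * theta q (l / x) * qfact_inf (1 / (a * x)) q)"
  \<comment> \<open>If this constant vanishes, all terms vanish and \<open>0 / 0\<close> could occur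
    in the general quotient, so the simpler quotient \<open>0 / 1\<close> is used.\<close>
  proof (cases "theta q (a * l) = 0")
    case True
    have t0: "t n w = 0" if "w \<in> E" for n w using t[OF that] True by (simp add: K_def)
    have "continued_sum E t x = 0 / 1"
      by (rule continued_sum_eq[where V=E and A="\<lambda>_. 0" and B="\<lambda>_. 1"])
        (use openE connE xE t0 in \<open>auto simp: summable_on_0 infsum_0\<close>)
    then show ?thesis using True by simp
  next
    case False
    have Knz: "K w \<noteq> 0" if "w \<in> E" for w
      using that False qa l_nz0 by (auto simp: K_def E_eq)
    have sum: "(\<Sum>\<^sub>\<infinity>n. t n w) * (qfact_inf (q / a) q * qfact_inf (- l) q * qfact_inf (- q / l) q * theta q (l / w) * qfact_inf (1 / (a * w)) q)
        = theta q (a * l) * theta q (l / (a * w))" 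
      if w: "w \<in> E" and sm: "(\<lambda>n. t n w) summable_on UNIV" for w
    proof -
      let ?z = "1 / (a * w)"
      have z0: "?z \<noteq> 0" using a E0[OF w] by simp
      have "(\<lambda>n. inverse (K w) * t n w) summable_on UNIV"
        using sm by (rule summable_on_cmult_right)
      then have sm': "(\<lambda>n. qfact (- l) q n * ?z powi n) summable_on UNIV"
        using Knz[OF w] by (simp add: t[OF w] mult.assoc[symmetric])
      define S where "S = (\<Sum>\<^sub>\<infinity>n. qfact (- l) q n * ?z powi n)"
      have "(\<Sum>\<^sub>\<infinity>n. t n w) = K w * S"
        unfolding t[OF w] S_def by (rule infsum_cmult_right')
      moreover have "S * qfact_inf ?z q * qfact_inf (- q / l) q = theta q (l / (a * w))"
        unfolding S_def using ramanujan_psi_sum[OF ml _ z0 sm'] l z0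
          jacobi_triple_product[of "l / (a * w)"] by simp
      moreover have "K w * (qfact_inf (q / a) q * qfact_inf (- l) q * theta q (l / w)) = theta q (a * l)"
        using Knz[OF w] unfolding K_def by simp
      moreover have "k * s * (A * B * C * D * G) = k * (A * B * D) * (s * G * C)" for k s A B C D G :: complex
        by (simp only: mult_ac)
      ultimately show ?thesis by (simp only:)
    qed
    \<comment> \<open>The unit ball around \<open>r\<close> lies where
      \<open>norm v > 1 / norm a\<close>; being uncountable, it contains a point off the spiral, so
      \<open>V\<close> is nonempty.\<close>
    define r where "r = 1 / norm a + 2"
    have r: "r > 0" unfolding r_def by (simp add: add_nonneg_pos)
    have "uncountable (ball (of_real r) 1 :: complex set)" by (rule uncountable_ball) simp
    moreover have "countable (insert 0 (q_spiral (- l) q))" using countable_q_spiral by simp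
    ultimately obtain v where v: "v \<in> ball (of_real r) 1" "v \<notin> insert 0 (q_spiral (- l) q)"
      by (meson countable_subset subsetI)
    have "norm (of_real r :: complex) - norm v \<le> norm (of_real r - v)"
      by (rule norm_triangle_ineq2)
    then have "1 / norm a < norm v" using v(1) r by (simp add: dist_norm) (simp add: r_def)
    then have v1: "norm (a * v) > 1" using a(1) by (simp add: norm_mult field_simps)
    show ?thesis
    proof (rule continued_sum_eq[where V="E \<inter> {w. norm (a * w) > 1}"])
      show "open (E \<inter> {w. norm (a * w) > 1})"
        using openE by (intro open_Int open_Collect_less continuous_intros)
      show "E \<inter> {w. norm (a * w) > 1} \<noteq> {}" using v v1 by (auto simp: E_def)
      show "(\<lambda>w. theta q (a * l) * theta q (l / (a * w))) holomorphic_on E"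
        using a l E0 by (intro holomorphic_intros) auto
      show "(\<lambda>w. qfact_inf (q / a) q * qfact_inf (- l) q * qfact_inf (- q / l) q * theta q (l / w) *
          qfact_inf (1 / (a * w)) q) holomorphic_on E"
      proof -
        have "(\<lambda>w. 1 / (a * w)) holomorphic_on E"
          using a E0 by (intro holomorphic_intros) auto
        then have "(\<lambda>w. qfact_inf (1 / (a * w)) q) holomorphic_on E"
          by (rule qfact_inf_holomorphic_on)
        moreover have "(\<lambda>w. theta q (l / w)) holomorphic_on E"
          using th_hol by (rule holomorphic_on_subset) (use E0 in auto)
        ultimately show ?thesis by (intro holomorphic_on_mult holomorphic_on_const)
      qed
      show "qfact_inf (q / a) q * qfact_inf (- l) q * qfact_inf (- q / l) q * theta q (l / w) *
          qfact_inf (1 / (a * w)) q \<noteq> 0" "(\<lambda>n. t n w) summable_on UNIV"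
        if "w \<in> E \<inter> {w. norm (a * w) > 1}" for w
      proof -
        have w: "w \<in> E" "norm (1 / (a * w)) < 1"
        proof -
          have "1 < norm (a * w)" using that by simp
          then have "1 / norm (a * w) < 1" by (subst divide_less_eq_1_pos) linarith+
          then show "norm (1 / (a * w)) < 1" by (simp add: norm_divide)
        qed (use that in simp)
        then show "qfact_inf (q / a) q * qfact_inf (- l) q * qfact_inf (- q / l) q * theta q (l / w) *
          qfact_inf (1 / (a * w)) q \<noteq> 0"
          using qa l_nz0 qfact_inf_nz[OF w(2)] by (auto simp: E_eq)
        show "(\<lambda>n. t n w) summable_on UNIV"
          unfolding t[OF w(1)] using l w(2)
          by (intro summable_on_cmult_right summable_on_qfact) auto
      qed
      show "isCont (\<lambda>w. \<Sum>\<^sub>\<infinity>n. t n w) w \<and> (\<forall>\<^sub>F u in at w. (\<lambda>n. t n u) summable_on UNIV)"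
        if w: "w \<in> E" "(\<lambda>n. t n w) summable_on UNIV" and B0: "qfact_inf (q / a) q * qfact_inf (- l) q *
          qfact_inf (- q / l) q * theta q (l / w) * qfact_inf (1 / (a * w)) q = 0" for w
      proof -
        \<comment> \<open>The case is contradictory: convergence would equate 0 with a nonzero
          numerator.\<close>
        have "qfact_inf (1 / (a * w)) q = 0" using B0 qa l_nz0 w by (auto simp: E_eq)
        then show ?thesis using lz[OF w(1)] sum[OF w] B0 False by simp
      qed
      show "theta q (a * l) * theta q (l / (a * x)) \<noteq> 0 \<or> qfact_inf (q / a) q * qfact_inf (- l) q *
          qfact_inf (- q / l) q * theta q (l / x) * qfact_inf (1 / (a * x)) q \<noteq> 0"
        using lz[OF xE] False qa l_nz0 xE by (auto simp: E_eq)
    qed (use openE connE xE sum in auto)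
  qed
  then show ?thesis unfolding q_laplace_def E_def t_def .
qed

end

theorem theorem2:
  fixes q a l x :: complex
  assumes "0 < norm q" and "norm q < 1"
    and "a \<noteq> 0" and "\<And>k::nat. k \<ge> 1 \<Longrightarrow> a \<noteq> q ^ k"
    and "l \<noteq> 0" and "l \<notin> q_spiral (-1) q"
    and "x \<noteq> 0" and "x \<notin> q_spiral (- l) q"
  shows "q_laplace q l (q_borel q (psi_1_0 a q)) x =
    qfact_inf q q / qfact_inf (q / a) q *
    (theta q (a * l) * theta q (a * q * x / l) / (theta q l * theta q (q * x / l))) *
    phi_1_0 q (1 / (a * x))"
proof -
  have q: "q \<noteq> 0" "norm q < 1" using assms by auto
  \<comment> \<open>It remains to reflect two thetas and to expand \<open>theta q l\<close>, whose
    factor \<open>qfact_inf q q\<close> cancels the one in the claimed prefactor.\<close>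
  have "theta q (a * q * x / l) = theta q (l / (a * x))" "theta q (q * x / l) = theta q (l / x)"
    using theta_reflect[OF q, of "l / (a * x)"] theta_reflect[OF q, of "l / x"] assms by (simp_all add: mult_ac)
  moreover have "theta q l = qfact_inf q q * qfact_inf (- l) q * qfact_inf (- q / l) q"
    by (rule jacobi_triple_product[OF q assms(5)])
  ultimately show ?thesis
    using q_laplace_q_borel_psi_1_0[OF q assms(3-8)] qfact_inf_q_nz[OF q]
    by (simp add: phi_1_0_eq[OF q])
qed

end
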